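(* Let $n\geq 2$, let $K$ be a unique factorization domain of characteristic $p>0$, and let $d$ be a nonzero $K$-derivation of the polynomial $K$-algebra $K[x_1,\dots,x_n]$ such that $d(x_1),\dots,d(x_n)$ are (in common) coprime, i.e. $\gcd(d(x_1),\dots,d(x_n))\sim 1$. The following conditions are equivalent: (1) $K[x_1,\dots,x_n]^d$ has a $p$-basis over $K[x_1^p,\dots,x_n^p]$ consisting of $n-1$ elements; (2) $d$ is a Jacobian derivation; (3) there exist polynomials $f_1,\dots,f_{n-1}\in K[x_1,\dots,x_n]^d$ such that $\operatorname{dgcd}(f_1,\dots,f_{n-1})\sim 1$.
   Context: A domain is a commutative ring with unity and without zero divisors. For a derivation $d$ of a domain $A$, the ring of constants $A^d$ is the kernel of $d$. $p$-basis: let $R$ be a domain of characteristic $p>0$ and $B$ a subring of $R$ containing $R^p=\{a^p : a\in R\}$. Elements $z_1,\dots,z_m\in R$ form a $p$-basis of $R$ over $B$ if the elements $z_1^{i_1}\cdots z_m^{i_m}$ with $0\leq i_1,\dots,i_m<p$ form a basis of $R$ as a $B$-module. Jacobian derivation: for $F=(f_1,\dots,f_{n-1})$ with $f_1,\dots,f_{n-1}\in K[x_1,\dots,x_n]$, let $d_F$ be the $K$-derivation of $K[x_1,\dots,x_n]$ given by $d_F(g)=\operatorname{jac}(f_1,\dots,f_{n-1},g)$, where $\operatorname{jac}$ is the Jacobian determinant with respect to $x_1,\dots,x_n$. A derivation is called a Jacobian derivation if it equals $d_F$ for some such $F$. Differential gcd: for $f_1,\dots,f_m\in K[x_1,\dots,x_n]$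 ($m\geq 1$) and $j_1,\dots,j_m\in\{1,\dots,n\}$ let $\operatorname{jac}^{f_1,\dots,f_m}_{j_1,\dots,j_m}$ be the Jacobian determinant of $f_1,\dots,f_m$ with respect to $x_{j_1},\dots,x_{j_m}$. Then $\operatorname{dgcd}(f_1,\dots,f_m)$ is the greatest common divisor of all $\operatorname{jac}^{f_1,\dots,f_m}_{j_1,\dots,j_m}$, $j_1,\dots,j_m\in\{1,\dots,n\}$ (and is $0$ if all of these are $0$); it is determined up to associates. For polynomials $g,h$, $g\sim h$ means that $g=ah$ for some invertible element $a\in K$. *)

theory Defs
  imports
    "HOL-Library.Poly_Mapping"
    "HOL-Library.FuncSet"
    "HOL-Library.Cardinality"
    "HOL-Computational_Algebra.Factorial_Ring"
    "Jordan_Normal_Form.Determinant"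
begin

text \<open>
  The polynomial ring over \<open>'k\<close> in \<open>CARD('n)\<close> variables, one for each element of the finite
  type \<open>'n\<close>: a polynomial maps each exponent vector to its coefficient, with finite support.
  The linear order on \<open>'n\<close> fixes the numbering of the variables.
\<close>

type_synonym ('n, 'k) mpoly = "('n \<Rightarrow>\<^sub>0 nat) \<Rightarrow>\<^sub>0 'k"

definition Const :: "'k::comm_ring_1 \<Rightarrow> ('n, 'k) mpoly" where
  "Const c = Poly_Mapping.single 0 c"

definition Var :: "'n \<Rightarrow> ('n, 'k::comm_ring_1) mpoly" where
  "Var j = Poly_Mapping.single (Poly_Mapping.single j 1) 1"

text \<open>The relation \<open>g \<sim> h\<close>; the unit is taken in \<open>'k\<close>.\<close>

definition sim :: "('n, 'k::comm_ring_1) mpoly \<Rightarrow> ('n, 'k) mpoly \<Rightarrow> bool" (infix "\<sim>" 50) where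
  "g \<sim> h \<longleftrightarrow> (\<exists>a. a dvd 1 \<and> g = Const a * h)"

text \<open>
  A greatest common divisor of a set of elements is determined only up to associates, hence the
  relational form.  For \<open>S = {0}\<close> it is \<open>0\<close>.
\<close>

definition is_gcd_of :: "'a::comm_semiring_1 \<Rightarrow> 'a set \<Rightarrow> bool" where
  "is_gcd_of g S \<longleftrightarrow> (\<forall>s\<in>S. g dvd s) \<and> (\<forall>h. (\<forall>s\<in>S. h dvd s) \<longrightarrow> h dvd g)"

definition K_derivation :: "(('n, 'k::comm_ring_1) mpoly \<Rightarrow> ('n, 'k) mpoly) \<Rightarrow> bool" where
  "K_derivation d \<longleftrightarrow>
     (\<forall>f g. d (f + g) = d f + d g) \<and>
     (\<forall>c f. d (Const c * f) = Const c * d f) \<and>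
     (\<forall>f g. d (f * g) = d f * g + f * d g)"

definition constants :: "('a::comm_ring_1 \<Rightarrow> 'a) \<Rightarrow> 'a set" where
  "constants d = {a. d a = 0}"

text \<open>The \<open>'k\<close>-subalgebra generated by a set of polynomials.\<close>

inductive_set generated_subalgebra :: "('n, 'k::comm_ring_1) mpoly set \<Rightarrow> ('n, 'k) mpoly set"
  for S where
  const: "Const c \<in> generated_subalgebra S"
| gen: "s \<in> S \<Longrightarrow> s \<in> generated_subalgebra S"
| add: "f \<in> generated_subalgebra S \<Longrightarrow> g \<in> generated_subalgebra S \<Longrightarrow> f + g \<in> generated_subalgebra S"
| mult: "f \<in> generated_subalgebra S \<Longrightarrow> g \<in> generated_subalgebra S \<Longrightarrow> f * g \<in> generated_subalgebra S"

text \<open>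
  \<open>z 0, \<dots>, z (m - 1)\<close> is a \<open>p\<close>-basis of \<open>R\<close> over \<open>B\<close>.  Meant for a subring \<open>R\<close>
  of characteristic \<open>p\<close> of the ambient type and a subring \<open>B\<close> of \<open>R\<close> containing all \<open>p\<close>-th powers
  of elements of \<open>R\<close>.  Independence is that of the family indexed by exponent tuples, so in
  particular different tuples give different monomials.
\<close>

definition p_basis :: "nat \<Rightarrow> 'a::comm_ring_1 set \<Rightarrow> 'a set \<Rightarrow> nat \<Rightarrow> (nat \<Rightarrow> 'a) \<Rightarrow> bool" where
  "p_basis p R B m z \<longleftrightarrow>
     (let I = {..<m} \<rightarrow>\<^sub>E {..<p}; mon = (\<lambda>e. \<Prod>i<m. z i ^ e i) in
       (\<forall>i<m. z i \<in> R) \<and>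
       (\<forall>r\<in>R. \<exists>b. (\<forall>e\<in>I. b e \<in> B) \<and> r = (\<Sum>e\<in>I. b e * mon e)) \<and>
       (\<forall>b. (\<forall>e\<in>I. b e \<in> B) \<and> (\<Sum>e\<in>I. b e * mon e) = 0 \<longrightarrow> (\<forall>e\<in>I. b e = 0)))"

text \<open>
  The formal partial derivative.  The truncated subtraction of exponents is harmless, because the
  coefficient vanishes when the exponent of the variable is \<open>0\<close>.
\<close>

definition partial_deriv :: "'n \<Rightarrow> ('n, 'k::comm_ring_1) mpoly \<Rightarrow> ('n, 'k) mpoly" where
  "partial_deriv j f =
     (\<Sum>e\<in>Poly_Mapping.keys f.
        Poly_Mapping.single (e - Poly_Mapping.single j 1)
          (of_nat (Poly_Mapping.lookup e j) * Poly_Mapping.lookup f e))"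

text \<open>
  The Jacobian determinant of \<open>f 0, \<dots>, f (m - 1)\<close> with respect to the variables
  \<open>js 0, \<dots>, js (m - 1)\<close>.
\<close>

definition jac :: "nat \<Rightarrow> (nat \<Rightarrow> ('n, 'k::comm_ring_1) mpoly) \<Rightarrow> (nat \<Rightarrow> 'n) \<Rightarrow> ('n, 'k) mpoly" where
  "jac m f js = Determinant.det (Matrix.mat m m (\<lambda>(i, k). partial_deriv (js k) (f i)))"

definition nth_var :: "nat \<Rightarrow> 'n::{finite, linorder}" where
  "nth_var k = sorted_list_of_set (UNIV :: 'n set) ! k"

text \<open>Only the entries \<open>F 0, \<dots>, F (CARD('n) - 2)\<close> are used.\<close>

definition jacobian_derivation_of ::
    "(nat \<Rightarrow> ('n::{finite, linorder}, 'k::comm_ring_1) mpoly) \<Rightarrow> ('n, 'k) mpoly \<Rightarrow> ('n, 'k) mpoly" where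
  "jacobian_derivation_of F g =
     jac CARD('n) (\<lambda>i. if i < CARD('n) - 1 then F i else g) nth_var"

definition is_jacobian_derivation ::
    "(('n::{finite, linorder}, 'k::comm_ring_1) mpoly \<Rightarrow> ('n, 'k) mpoly) \<Rightarrow> bool" where
  "is_jacobian_derivation d \<longleftrightarrow> (\<exists>F. d = jacobian_derivation_of F)"

definition is_dgcd :: "('n, 'k::comm_ring_1) mpoly \<Rightarrow> nat \<Rightarrow> (nat \<Rightarrow> ('n, 'k) mpoly) \<Rightarrow> bool" where
  "is_dgcd g m f \<longleftrightarrow> is_gcd_of g (range (\<lambda>js. jac m f js))"

end

theory Submission
  imports
    Defs
    "HOL-Computational_Algebra.Polynomial"
    "HOL-Number_Theory.Cong"
begin

text \<open>
  Write \<open>A\<close> for the polynomial ring, \<open>B\<close> for its subring of polynomials in the \<open>p\<close>-th powers of the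
  variables, and \<open>D\<close> for the Jacobian derivation of \<open>f\<^sub>1, \<dots>, f\<^sub>n\<^sub>-\<^sub>1 \<in> A\<^sup>d\<close>.  The maximal minors of the
  Jacobian matrix of the \<open>f\<^sub>i\<close> are, up to sign, the \<open>D x\<^sub>j\<close>, so (3) says that the \<open>D x\<^sub>j\<close> are coprime.
  Cramer's rule gives \<open>D g \<cdot> d x\<^sub>j = d g \<cdot> D x\<^sub>j\<close>; if both families of coefficients are coprime, \<open>d\<close> and
  \<open>D\<close> differ by a unit constant, which can be absorbed into \<open>f\<^sub>1\<close>.

  For (3) \<open>\<Rightarrow>\<close> (1), suppose \<open>b \<in> B\<close> divides \<open>\<Sum> b\<^sub>e f\<^sup>e\<close>.  Replacing one row of the Jacobian determinant of
  \<open>f, x\<^sub>j\<close> gives \<open>B\<close>-linear derivations acting on polynomials in \<open>f\<close> as \<open>D x\<^sub>j \<cdot> \<partial>/\<partial>f\<^sub>i\<close>; as the \<open>D x\<^sub>j\<close> are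
  coprime, iterating them shows that \<open>b\<close> divides every \<open>b\<^sub>e\<close>.  The case \<open>b = 0\<close> is the independence of the
  \<open>f\<^sup>e\<close>.  Counting ranks over \<open>B\<close>, every \<open>g \<in> A\<^sup>d\<close> has a multiple \<open>b g = \<Sum> b\<^sub>e f\<^sup>e\<close>, and \<open>b\<close> can be divided out.

  For (1) \<open>\<Rightarrow>\<close> (3), put \<open>u = d x\<^sub>j \<noteq> 0\<close>.  The slice theorem for \<open>u\<inverse> d\<close> writes \<open>u\<^sup>N x\<^sub>k\<close> as a polynomial in \<open>x\<^sub>j\<close>
  over \<open>A\<^sup>d = B[f]\<close>, with \<open>p\<close> dividing \<open>N\<close>.  By the chain rule \<open>u\<^sup>N\<close> times the identity matrix is a
  multiple of the Jacobian matrix of \<open>f, x\<^sub>j\<close>, so \<open>D x\<^sub>j\<close> divides a power of \<open>d x\<^sub>j\<close>.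
\<close>

section \<open>Unique factorization relative to a subring\<close>

definition is_subring :: "'a::idom set \<Rightarrow> bool" where
  "is_subring R \<longleftrightarrow> 0 \<in> R \<and> 1 \<in> R \<and> (\<forall>a\<in>R. \<forall>b\<in>R. a + b \<in> R \<and> a - b \<in> R \<and> a * b \<in> R)"

text \<open>The quotient has to lie in the carrier \<open>R\<close>: the induction on the number of
  variables runs through the subrings \<open>polys_in V\<close> of one fixed type rather than
  through new types.\<close>

definition dvd_in :: "'a::idom set \<Rightarrow> 'a \<Rightarrow> 'a \<Rightarrow> bool" where
  "dvd_in R a b \<longleftrightarrow> (\<exists>c\<in>R. b = a * c)"

definition prime_in :: "'a::idom set \<Rightarrow> 'a \<Rightarrow> bool" where
  "prime_in R q \<longleftrightarrow> q \<in> R \<and> q \<noteq> 0 \<and> \<not> dvd_in R q 1 \<and>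
     (\<forall>a\<in>R. \<forall>b\<in>R. dvd_in R q (a * b) \<longrightarrow> dvd_in R q a \<or> dvd_in R q b)"

definition irred_in :: "'a::idom set \<Rightarrow> 'a \<Rightarrow> bool" where
  "irred_in R q \<longleftrightarrow> q \<in> R \<and> q \<noteq> 0 \<and> \<not> dvd_in R q 1 \<and>
     (\<forall>a\<in>R. \<forall>b\<in>R. q = a * b \<longrightarrow> dvd_in R a 1 \<or> dvd_in R b 1)"

text \<open>An additive length that vanishes only at units stands in for the existence of
  factorizations. It bounds the number of non-unit factors, extends easily to polynomials and moves
  along isomorphisms.\<close>

definition ufd_length :: "'a::idom set \<Rightarrow> ('a \<Rightarrow> nat) \<Rightarrow> bool" where
  "ufd_length R len \<longleftrightarrow>
     (\<forall>a\<in>R - {0}. \<forall>b\<in>R - {0}. len (a * b) = len a + len b) \<and>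
     (\<forall>a\<in>R - {0}. len a = 0 \<longrightarrow> dvd_in R a 1)"

definition ufd_on :: "'a::idom set \<Rightarrow> bool" where
  "ufd_on R \<longleftrightarrow> is_subring R \<and> (\<exists>len. ufd_length R len) \<and> (\<forall>q. irred_in R q \<longrightarrow> prime_in R q)"

definition poly_over :: "'a::idom set \<Rightarrow> 'a poly set" where
  "poly_over R = {P. \<forall>i. coeff P i \<in> R}"

section \<open>Subrings, relative divisibility and prime factors\<close>

lemma
  assumes "is_subring R"
  shows is_subring_0: "0 \<in> R" and is_subring_1: "1 \<in> R"
    and is_subring_add: "a \<in> R \<Longrightarrow> b \<in> R \<Longrightarrow> a + b \<in> R"
    and is_subring_diff: "a \<in> R \<Longrightarrow> b \<in> R \<Longrightarrow> a - b \<in> R"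
    and is_subring_mult: "a \<in> R \<Longrightarrow> b \<in> R \<Longrightarrow> a * b \<in> R"
  using assms by (auto simp: is_subring_def)

lemma is_subring_sum:
  assumes "is_subring R" "\<And>i. i \<in> I \<Longrightarrow> f i \<in> R"
  shows "sum f I \<in> R"
  using assms by (induction I rule: infinite_finite_induct) (auto simp: is_subring_def)

lemma is_subring_poly_over:
  assumes R: "is_subring R"
  shows "is_subring (poly_over R)"
proof -
  have "coeff (P * Q) i \<in> R" if "P \<in> poly_over R" "Q \<in> poly_over R" for P Q i
    unfolding coeff_mult using that R by (intro is_subring_sum) (auto simp: poly_over_def is_subring_def)
  then show ?thesis
    using R by (auto simp: poly_over_def is_subring_def coeff_1)
qed

lemma dvd_in_0 [simp]: "is_subring R \<Longrightarrow> dvd_in R a 0"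
  by (auto simp: dvd_in_def is_subring_def intro!: bexI[of _ 0])

lemma dvd_in_add: "is_subring R \<Longrightarrow> dvd_in R a b \<Longrightarrow> dvd_in R a c \<Longrightarrow> dvd_in R a (b + c)"
  unfolding dvd_in_def is_subring_def by (auto simp: distrib_left[symmetric])

lemma dvd_in_diff: "is_subring R \<Longrightarrow> dvd_in R a b \<Longrightarrow> dvd_in R a c \<Longrightarrow> dvd_in R a (b - c)"
  unfolding dvd_in_def is_subring_def by (auto simp: right_diff_distrib[symmetric])

lemma dvd_in_mult: "is_subring R \<Longrightarrow> dvd_in R a b \<Longrightarrow> c \<in> R \<Longrightarrow> dvd_in R a (b * c)"
  unfolding dvd_in_def is_subring_def by (auto simp: mult.assoc)

lemma dvd_in_mult': "is_subring R \<Longrightarrow> dvd_in R a b \<Longrightarrow> c \<in> R \<Longrightarrow> dvd_in R a (c * b)"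
  using dvd_in_mult[of R a b c] by (simp add: mult.commute)

lemma dvd_in_sum:
  assumes "is_subring R" "\<And>i. i \<in> I \<Longrightarrow> dvd_in R a (f i)"
  shows "dvd_in R a (sum f I)"
  using assms by (induction I rule: infinite_finite_induct) (auto simp: dvd_in_add)

text \<open>Of two non-unit factors of a reducible \<open>a\<close>, the second has positive length,
  so the first is shorter than \<open>a\<close> and has a prime factor by induction.\<close>

lemma prime_factor_exists_in:
  assumes len: "ufd_length R len" and R: "is_subring R"
    and irr: "\<And>q. irred_in R q \<Longrightarrow> prime_in R q"
    and "a \<in> R" "a \<noteq> 0" "\<not> dvd_in R a 1"
  shows "\<exists>q b. prime_in R q \<and> b \<in> R \<and> a = q * b"
  using assms(4-)
proof (induction "len a" arbitrary: a rule: less_induct)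
  case less
  show ?case
  proof (cases "irred_in R a")
    case True
    then show ?thesis using irr R by (intro exI[of _ a] exI[of _ 1]) (auto simp: is_subring_def)
  next
    case False
    then obtain b c where bc: "b \<in> R" "c \<in> R" "a = b * c" "\<not> dvd_in R b 1" "\<not> dvd_in R c 1"
      using less.prems by (auto simp: irred_in_def)
    have nz: "b \<noteq> 0" "c \<noteq> 0" using bc less.prems by auto
    have "len a = len b + len c" using len bc nz by (auto simp: ufd_length_def)
    moreover have "len c \<noteq> 0" using len bc nz by (auto simp: ufd_length_def)
    ultimately have "len b < len a" by simp
    from less.hyps[OF this bc(1) nz(1) bc(4)] obtain q e
      where "prime_in R q" "e \<in> R" "b = q * e" by auto
    then show ?thesis using bc R
      by (intro exI[of _ q] exI[of _ "e * c"]) (auto simp: is_subring_def)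
  qed
qed

text \<open>Splitting off a prime factor lowers the length, because a prime is a non-unit and so has
  positive length. Later proofs use unique factorization in this form.\<close>

lemma ufd_on_induct [consumes 3, case_names unit prime]:
  assumes ufd: "ufd_on R" and "a \<in> R" "a \<noteq> 0"
    and unit: "\<And>u. u \<in> R \<Longrightarrow> dvd_in R u 1 \<Longrightarrow> P u"
    and prime: "\<And>q b. prime_in R q \<Longrightarrow> b \<in> R \<Longrightarrow> b \<noteq> 0 \<Longrightarrow> P b \<Longrightarrow> P (q * b)"
  shows "P a"
proof -
  from ufd obtain len where len: "ufd_length R len" and R: "is_subring R"
    and irr: "\<And>q. irred_in R q \<Longrightarrow> prime_in R q" by (auto simp: ufd_on_def)
  show ?thesis using assms(2,3)
  proof (induction "len a" arbitrary: a rule: less_induct)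
    case less
    show ?case
    proof (cases "dvd_in R a 1")
      case True then show ?thesis using unit less.prems by simp
    next
      case False
      from prime_factor_exists_in[OF len R irr less.prems False] obtain q b
        where q: "prime_in R q" "b \<in> R" "a = q * b" by auto
      have nz: "q \<noteq> 0" "b \<noteq> 0" using q less.prems by auto
      have "len a = len q + len b" "len q \<noteq> 0"
        using len q nz by (auto simp: ufd_length_def prime_in_def)
      then have "P b" using less.hyps[of b] q nz by simp
      then show ?thesis using prime q nz by simp
    qed
  qed
qed

section \<open>Gauss's lemma and constant factors of polynomials\<close>

lemma poly_over_smult_iff:
  assumes "q \<noteq> 0" "P \<in> poly_over R" "is_subring R"
  shows "(\<exists>P'\<in>poly_over R. P = smult q P') \<longleftrightarrow> (\<forall>i. dvd_in R q (coeff P i))"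
proof
  assume "\<exists>P'\<in>poly_over R. P = smult q P'"
  then show "\<forall>i. dvd_in R q (coeff P i)" by (auto simp: poly_over_def dvd_in_def)
next
  assume "\<forall>i. dvd_in R q (coeff P i)"
  then obtain c where c: "\<And>i. c i \<in> R" "\<And>i. coeff P i = q * c i"
    unfolding dvd_in_def by metis
  \<comment> \<open>Where \<open>coeff P i\<close> vanishes, so does \<open>c i\<close>, as
    \<open>q\<close> is nonzero; hence the chosen quotients have finite support and form a
    polynomial.\<close>
  have "eventually (\<lambda>i. c i = 0) cofinite"
    using MOST_coeff_eq_0[of P] by eventually_elim (use c assms(1) in auto)
  then have "coeff (Abs_poly c) = c"
    by (simp add: Abs_poly_inverse)
  then show "\<exists>P'\<in>poly_over R. P = smult q P'"
    using c by (intro bexI[of _ "Abs_poly c"]) (auto simp: poly_over_def poly_eq_iff)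
qed

text \<open>Gauss's lemma. Let \<open>i\<close> and \<open>k\<close> be the least indices at which
  \<open>q\<close> fails to divide a coefficient of \<open>P\<close> and of \<open>Q\<close>. In the
  coefficient of \<open>P * Q\<close> at \<open>i + k\<close>, every product other than
  \<open>coeff P i * coeff Q k\<close> is divisible by \<open>q\<close>.\<close>

lemma gauss_in:
  assumes q: "prime_in R q" and R: "is_subring R" and PQ: "P \<in> poly_over R" "Q \<in> poly_over R"
    and dvd: "\<forall>i. dvd_in R q (coeff (P * Q) i)"
  shows "(\<forall>i. dvd_in R q (coeff P i)) \<or> (\<forall>i. dvd_in R q (coeff Q i))"
proof (rule ccontr)
  assume "\<not> ?thesis"
  then have ex: "\<exists>i. \<not> dvd_in R q (coeff P i)" "\<exists>i. \<not> dvd_in R q (coeff Q i)" by auto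
  define i where "i = (LEAST i. \<not> dvd_in R q (coeff P i))"
  define k where "k = (LEAST k. \<not> dvd_in R q (coeff Q k))"
  have i: "\<not> dvd_in R q (coeff P i)" "\<And>l. l < i \<Longrightarrow> dvd_in R q (coeff P l)"
    unfolding i_def using LeastI_ex[OF ex(1)] not_less_Least by auto
  have k: "\<not> dvd_in R q (coeff Q k)" "\<And>l. l < k \<Longrightarrow> dvd_in R q (coeff Q l)"
    unfolding k_def using LeastI_ex[OF ex(2)] not_less_Least by auto
  have mem: "coeff P l \<in> R" "coeff Q l \<in> R" for l using PQ by (auto simp: poly_over_def)
  have "coeff (P * Q) (i + k) = (\<Sum>l\<in>{..i+k}. coeff P l * coeff Q (i + k - l))"
    by (simp add: coeff_mult)
  also have "\<dots> = coeff P i * coeff Q k + (\<Sum>l\<in>{..i+k} - {i}. coeff P l * coeff Q (i + k - l))"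
    by (subst sum.remove[of _ i]) auto
  finally have eq: "coeff P i * coeff Q k =
      coeff (P * Q) (i + k) - (\<Sum>l\<in>{..i+k} - {i}. coeff P l * coeff Q (i + k - l))" by simp
  have "dvd_in R q (coeff P l * coeff Q (i + k - l))" if "l \<in> {..i+k} - {i}" for l
  proof (cases "l < i")
    case True then show ?thesis by (intro dvd_in_mult[OF R] i mem)
  next
    case False
    then have "i + k - l < k" using that by auto
    then show ?thesis by (intro dvd_in_mult'[OF R] k mem)
  qed
  then have "dvd_in R q (\<Sum>l\<in>{..i+k} - {i}. coeff P l * coeff Q (i + k - l))"
    by (intro dvd_in_sum[OF R])
  then have "dvd_in R q (coeff P i * coeff Q k)"
    unfolding eq using dvd by (intro dvd_in_diff[OF R]) auto
  then have "dvd_in R q (coeff P i) \<or> dvd_in R q (coeff Q k)"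
    using q mem[of i] mem[of k] by (auto simp: prime_in_def)
  then show False using i(1) k(1) by blast
qed

lemma smult_in_poly_over: "is_subring R \<Longrightarrow> c \<in> R \<Longrightarrow> P \<in> poly_over R \<Longrightarrow> smult c P \<in> poly_over R"
  by (auto simp: poly_over_def is_subring_def)

lemma smult_cancel: "c \<noteq> 0 \<Longrightarrow> smult c P = smult c Q \<Longrightarrow> P = (Q :: 'a::idom poly)"
  by (metis eq_iff_diff_eq_0 smult_diff_right smult_eq_0_iff)

text \<open>By Gauss's lemma each prime factor of \<open>c\<close> divides all coefficients of
  \<open>Q\<close> or all those of \<open>w\<close>; it is cancelled there and counted in
  \<open>c1\<close> or \<open>c2\<close>. This clears denominators in a factorization over the
  fraction field without forming that field.\<close>

lemma strip_constant:
  assumes ufd: "ufd_on R" and c: "c \<in> R" "c \<noteq> 0"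
    and "P \<in> poly_over R" "Q \<in> poly_over R" "w \<in> poly_over R" "smult c P = Q * w"
  shows "\<exists>c1\<in>R. \<exists>c2\<in>R. \<exists>Q'\<in>poly_over R. \<exists>w'\<in>poly_over R.
           c = c1 * c2 \<and> Q = smult c1 Q' \<and> w = smult c2 w' \<and> P = Q' * w'"
  using ufd c assms(4-)
proof (induction c arbitrary: P Q w rule: ufd_on_induct)
  case (unit u)
  have R: "is_subring R" using ufd by (simp add: ufd_on_def)
  obtain v where v: "v \<in> R" "1 = u * v" using unit by (auto simp: dvd_in_def)
  have "P = smult v (smult u P)" using v by (simp add: mult.commute)
  then have "P = smult v Q * w" using unit.prems(4) by simp
  moreover have "smult v Q \<in> poly_over R" by (rule smult_in_poly_over[OF R v(1) unit.prems(2)])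
  moreover have "Q = smult u (smult v Q)" "w = smult 1 w" "u = u * 1" using v by simp_all
  moreover have "1 \<in> R" using R by (simp add: is_subring_def)
  ultimately show ?case using unit(1) unit.prems(3) by blast
next
  case (prime q b)
  have R: "is_subring R" using ufd by (simp add: ufd_on_def)
  have q: "q \<noteq> 0" "q \<in> R" using prime.hyps by (auto simp: prime_in_def)
  have bP: "smult b P \<in> poly_over R" by (rule smult_in_poly_over[OF R prime.hyps(2) prime.prems(1)])
  have eq: "Q * w = smult q (smult b P)" using prime.prems(4) by simp
  have "Q * w \<in> poly_over R"
    by (rule is_subring_mult[OF is_subring_poly_over[OF R] prime.prems(2,3)])
  then have "\<forall>i. dvd_in R q (coeff (Q * w) i)"
    using poly_over_smult_iff[OF q(1) _ R, of "Q * w"] eq bP by blast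
  then have "(\<forall>i. dvd_in R q (coeff Q i)) \<or> (\<forall>i. dvd_in R q (coeff w i))"
    by (rule gauss_in[OF prime.hyps(1) R prime.prems(2,3)])
  then consider Q' where "Q' \<in> poly_over R" "Q = smult q Q'" | w' where "w' \<in> poly_over R" "w = smult q w'"
    using poly_over_smult_iff[OF q(1) prime.prems(2) R] poly_over_smult_iff[OF q(1) prime.prems(3) R]
    by blast
  then show ?case
  proof cases
    case 1
    then have "smult q (smult b P) = smult q (Q' * w)" using eq by simp
    then have "smult b P = Q' * w" using q smult_cancel by blast
    from prime.IH[OF prime.prems(1) 1(1) prime.prems(3) this] obtain c1 c2 Q'' w''
      where *: "c1 \<in> R" "c2 \<in> R" "Q'' \<in> poly_over R" "w'' \<in> poly_over R"
       "b = c1 * c2" "Q' = smult c1 Q''" "w = smult c2 w''" "P = Q'' * w''" by blast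
    have "q * c1 \<in> R" by (rule is_subring_mult[OF R q(2) *(1)])
    moreover have "q * b = q * c1 * c2" "Q = smult (q * c1) Q''" using * 1 by simp_all
    ultimately show ?thesis using *(2,3,4,7,8) by blast
  next
    case 2
    then have "smult q (smult b P) = smult q (Q * w')" using eq by simp
    then have "smult b P = Q * w'" using q smult_cancel by blast
    from prime.IH[OF prime.prems(1,2) 2(1) this] obtain c1 c2 Q'' w''
      where *: "c1 \<in> R" "c2 \<in> R" "Q'' \<in> poly_over R" "w'' \<in> poly_over R"
       "b = c1 * c2" "Q = smult c1 Q''" "w' = smult c2 w''" "P = Q'' * w''" by blast
    have "q * c2 \<in> R" by (rule is_subring_mult[OF R q(2) *(2)])
    moreover have "q * b = c1 * (q * c2)" "w = smult (q * c2) w''" using * 2 by simp_all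
    ultimately show ?thesis using *(1,3,4,6,8) by blast
  qed
qed

text \<open>Instead of dividing by the leading coefficient of \<open>w\<close>, each step multiplies
  \<open>Y\<close> by it. These factors collect in \<open>c\<close>, which stays nonzero in a
  domain.\<close>

lemma pseudo_division_over:
  assumes R: "is_subring R" and w: "w \<in> poly_over R" "w \<noteq> 0" and Y: "Y \<in> poly_over R"
  shows "\<exists>c\<in>R - {0}. \<exists>Q\<in>poly_over R. \<exists>r\<in>poly_over R.
           smult c Y = Q * w + r \<and> (r = 0 \<or> degree r < degree w)"
  using Y
\<comment> \<open>The measure places the zero polynomial strictly below the nonzero constants, which
  have the same degree.\<close>
proof (induction "if Y = 0 then 0 else Suc (degree Y)" arbitrary: Y rule: less_induct)
  case less
  have S: "is_subring (poly_over R)" by (rule is_subring_poly_over[OF R])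
  show ?case
  proof (cases "Y = 0 \<or> degree Y < degree w")
    case True
    then have "smult 1 Y = 0 * w + Y \<and> (Y = 0 \<or> degree Y < degree w)" by simp
    moreover have "1 \<in> R - {0}" using is_subring_1[OF R] by simp
    ultimately show ?thesis using is_subring_0[OF S] less.prems by blast
  next
    case False
    define k where "k = degree Y - degree w"
    define M where "M = monom (lead_coeff Y) k"
    define Y' where "Y' = smult (lead_coeff w) Y - M * w"
    have M: "M \<in> poly_over R"
      using less.prems is_subring_0[OF R] by (auto simp: M_def poly_over_def)
    have lw: "lead_coeff w \<in> R" "lead_coeff w \<noteq> 0" using w by (auto simp: poly_over_def)
    have Mw: "M * w \<in> poly_over R" by (rule is_subring_mult[OF S M w(1)])
    have Y': "Y' \<in> poly_over R"
      unfolding Y'_def by (rule is_subring_diff[OF S smult_in_poly_over[OF R lw(1) less.prems] Mw])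
    have M0: "M \<noteq> 0" using False by (simp add: M_def monom_eq_0_iff)
    have dM: "degree M = k" using False by (simp add: M_def degree_monom_eq)
    have dMw: "degree (M * w) = degree Y" using degree_mult_eq[OF M0 w(2)] dM False k_def by auto
    have "coeff Y' (degree Y) = 0"
    proof -
      have "coeff (M * w) (degree Y) = lead_coeff (M * w)" using dMw by simp
      also have "\<dots> = lead_coeff M * lead_coeff w" by (rule lead_coeff_mult)
      also have "lead_coeff M = lead_coeff Y" using dM by (simp add: M_def)
      finally show ?thesis by (simp add: Y'_def)
    qed
    moreover have "degree Y' \<le> degree Y"
      unfolding Y'_def by (rule degree_diff_le) (use dMw in auto)
    ultimately have "Y' = 0 \<or> degree Y' < degree Y"
      by (metis le_neq_implies_less leading_coeff_0_iff)
    then have lt: "(if Y' = 0 then 0 else Suc (degree Y')) < (if Y = 0 then 0 else Suc (degree Y))"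
      using False by auto
    from less.hyps[OF lt Y'] obtain c Q r where *: "c \<in> R" "c \<noteq> 0" "Q \<in> poly_over R" "r \<in> poly_over R"
      "smult c Y' = Q * w + r" "r = 0 \<or> degree r < degree w" by blast
    have "smult (c * lead_coeff w) Y = (smult c M + Q) * w + r"
    proof -
      have "smult (c * lead_coeff w) Y = smult c (Y' + M * w)" by (simp add: Y'_def)
      also have "\<dots> = smult c Y' + smult c M * w" by (simp add: smult_add_right)
      also have "\<dots> = (smult c M + Q) * w + r" using *(5) by (simp add: algebra_simps)
      finally show ?thesis .
    qed
    moreover have "c * lead_coeff w \<in> R - {0}" using * lw is_subring_mult[OF R] by simp
    moreover have "smult c M + Q \<in> poly_over R"
      by (rule is_subring_add[OF S smult_in_poly_over[OF R *(1) M] *(3)])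
    ultimately show ?thesis using *(4,6) by blast
  qed
qed

section \<open>Polynomial rings over factorial subrings are factorial\<close>

lemma const_in_poly_over: "is_subring R \<Longrightarrow> c \<in> R \<Longrightarrow> [:c:] \<in> poly_over R"
  by (auto simp: poly_over_def is_subring_0 coeff_pCons split: nat.split)

lemma unit_in_poly_over:
  assumes R: "is_subring R" and P: "P \<in> poly_over R" and u: "dvd_in (poly_over R) P 1"
  obtains v where "P = [:v:]" "v \<in> R" "dvd_in R v 1"
proof -
  from u obtain Q where Q: "Q \<in> poly_over R" "1 = P * Q" by (auto simp: dvd_in_def)
  have "P \<noteq> 0" "Q \<noteq> 0" using Q(2) by auto
  from degree_mult_eq[OF this] have deg: "degree P = 0" "degree Q = 0" unfolding Q(2)[symmetric] by simp_all
  from deg(1) obtain v where v: "P = [:v:]" by (metis degree_0_id)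
  from deg(2) obtain w where w: "Q = [:w:]" by (metis degree_0_id)
  have "v \<in> R" "w \<in> R" using P Q(1) unfolding v w poly_over_def by (auto dest: spec[of _ 0])
  moreover have "1 = v * w" using Q(2) unfolding v w by (simp add: one_pCons mult.commute)
  ultimately show ?thesis using that v by (auto simp: dvd_in_def)
qed

lemma degree_0_in_poly_over:
  assumes "P \<in> poly_over R" "degree P = 0"
  obtains a where "P = [:a:]" "a \<in> R"
proof -
  have "P = [:coeff P 0:]" using degree_0_id[OF assms(2)] by simp
  moreover have "coeff P 0 \<in> R" using assms(1) by (simp add: poly_over_def)
  ultimately show ?thesis by (rule that)
qed

lemma irred_in_const:
  assumes R: "is_subring R" and a: "irred_in (poly_over R) [:a:]" "a \<in> R"
  shows "irred_in R a"
  unfolding irred_in_def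
proof (intro conjI ballI impI)
  note S = is_subring_poly_over[OF R]
  show "a \<in> R" "a \<noteq> 0" using a by (auto simp: irred_in_def)
  show "\<not> dvd_in R a 1"
  proof
    assume "dvd_in R a 1"
    then obtain c where "c \<in> R" "1 = a * c" by (auto simp: dvd_in_def)
    then have "1 = [:a:] * [:c:]" "[:c:] \<in> poly_over R"
      using const_in_poly_over[OF R] by (simp_all add: one_pCons mult.commute)
    then show False using a unfolding irred_in_def dvd_in_def by blast
  qed
  fix b c assume bc: "b \<in> R" "c \<in> R" "a = b * c"
  then have "[:b:] \<in> poly_over R" "[:c:] \<in> poly_over R" "[:a:] = [:b:] * [:c:]"
    using const_in_poly_over[OF R] by simp_all
  then have "dvd_in (poly_over R) [:b:] 1 \<or> dvd_in (poly_over R) [:c:] 1"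
    using a(1) unfolding irred_in_def by blast
  moreover have "dvd_in R v 1" if "v \<in> R" "dvd_in (poly_over R) [:v:] 1" for v
    using unit_in_poly_over[OF R const_in_poly_over[OF R that(1)] that(2)]
    by (metis pCons_eq_iff)
  ultimately show "dvd_in R b 1 \<or> dvd_in R c 1" using bc by blast
qed

text \<open>Divisibility by a constant is divisibility of all coefficients, so this is Gauss's lemma
  again.\<close>

lemma prime_in_const:
  assumes R: "is_subring R" and a: "prime_in R a"
  shows "prime_in (poly_over R) [:a:]"
  unfolding prime_in_def
proof (intro conjI ballI impI)
  have a': "a \<in> R" "a \<noteq> 0" using a by (auto simp: prime_in_def)
  show "[:a:] \<in> poly_over R" "[:a:] \<noteq> 0" using a' const_in_poly_over[OF R] by auto
  show "\<not> dvd_in (poly_over R) [:a:] 1"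
  proof
    assume "dvd_in (poly_over R) [:a:] 1"
    from unit_in_poly_over[OF R const_in_poly_over[OF R a'(1)] this]
    show False using a by (metis pCons_eq_iff prime_in_def)
  qed
  have iff: "dvd_in (poly_over R) [:a:] P \<longleftrightarrow> (\<forall>i. dvd_in R a (coeff P i))" if "P \<in> poly_over R" for P
    using poly_over_smult_iff[OF a'(2) that R] by (simp add: dvd_in_def)
  fix P Q assume PQ: "P \<in> poly_over R" "Q \<in> poly_over R" "dvd_in (poly_over R) [:a:] (P * Q)"
  have "P * Q \<in> poly_over R" by (rule is_subring_mult[OF is_subring_poly_over[OF R] PQ(1,2)])
  then have "\<forall>i. dvd_in R a (coeff (P * Q) i)" using iff PQ(3) by blast
  from gauss_in[OF a R PQ(1,2) this] show "dvd_in (poly_over R) [:a:] P \<or> dvd_in (poly_over R) [:a:] Q"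
    using iff PQ by blast
qed

text \<open>Split \<open>c\<close> between \<open>P\<close> and \<open>Y\<close>. The share taken
  from \<open>P\<close> is a unit, since \<open>P\<close> is irreducible of positive degree; so
  \<open>P\<close> divides \<open>G\<close> and not only \<open>smult c G\<close>.\<close>

lemma irred_in_strip:
  assumes ufd: "ufd_on R" and P: "irred_in (poly_over R) P" "degree P > 0"
    and c: "c \<in> R" "c \<noteq> 0" and YG: "Y \<in> poly_over R" "G \<in> poly_over R" "smult c G = P * Y"
  shows "dvd_in (poly_over R) P G"
proof -
  have R: "is_subring R" using ufd by (simp add: ufd_on_def)
  note S = is_subring_poly_over[OF R]
  have PS: "P \<in> poly_over R" using P by (simp add: irred_in_def)
  from strip_constant[OF ufd c YG(2) PS YG(1,3)] obtain c1 c2 P' Y'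
    where *: "c1 \<in> R" "c2 \<in> R" "P' \<in> poly_over R" "Y' \<in> poly_over R"
      "c = c1 * c2" "P = smult c1 P'" "Y = smult c2 Y'" "G = P' * Y'" by blast
  have "P = [:c1:] * P'" using * by simp
  then have "dvd_in (poly_over R) [:c1:] 1 \<or> dvd_in (poly_over R) P' 1"
    using P(1) *(3) const_in_poly_over[OF R *(1)] unfolding irred_in_def by blast
  moreover have "\<not> dvd_in (poly_over R) P' 1"
  proof
    assume "dvd_in (poly_over R) P' 1"
    then obtain v where "P' = [:v:]" using unit_in_poly_over[OF R *(3)] by metis
    then have "degree P = 0" unfolding *(6) by simp
    then show False using P(2) by simp
  qed
  ultimately have "dvd_in (poly_over R) [:c1:] 1" by blast
  then obtain u where u: "u \<in> poly_over R" "1 = [:c1:] * u" by (auto simp: dvd_in_def)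
  have "P * (u * Y') = ([:c1:] * u) * (P' * Y')" unfolding \<open>P = [:c1:] * P'\<close> by (simp only: mult_ac)
  then have "P * (u * Y') = G" unfolding u(2)[symmetric] *(8)[symmetric] by simp
  then have "G = P * (u * Y')" by (rule sym)
  then show ?thesis unfolding dvd_in_def by (rule bexI[OF _ is_subring_mult[OF S u(1) *(4)]])
qed

text \<open>Constants are handled in \<open>R\<close>. For positive degree, pseudo-division imitates
  Euclid's algorithm over the fraction field: an element \<open>w\<close> of least degree in the
  ideal generated by \<open>P\<close> and \<open>G\<close> divides both up to nonzero constants. As
  \<open>P\<close> is irreducible, either \<open>w\<close> is a constant multiple of an associate of
  \<open>P\<close> and then \<open>P\<close> divides \<open>G\<close>, or \<open>w\<close> is a
  constant and then \<open>P\<close> divides \<open>H\<close>.\<close>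

lemma irred_in_imp_prime_in_poly_over:
  assumes ufd: "ufd_on R" and P: "irred_in (poly_over R) P"
  shows "prime_in (poly_over R) P"
proof -
  have R: "is_subring R" using ufd by (simp add: ufd_on_def)
  note S = is_subring_poly_over[OF R]
  have PS: "P \<in> poly_over R" and P0: "P \<noteq> 0" using P by (auto simp: irred_in_def)
  show ?thesis
  proof (cases "degree P = 0")
    case True
    then obtain a where a: "P = [:a:]" "a \<in> R" using degree_0_in_poly_over[OF PS] by blast
    then have "prime_in R a" using irred_in_const[OF R _ a(2)] P ufd by (simp add: ufd_on_def)
    then show ?thesis using prime_in_const[OF R] a by simp
  next
    case False
    then have dP: "degree P > 0" by simp
    have "dvd_in (poly_over R) P G \<or> dvd_in (poly_over R) P H"
      if G: "G \<in> poly_over R" and H: "H \<in> poly_over R" and dvd: "dvd_in (poly_over R) P (G * H)" for G H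
    proof -
      obtain Z where Z: "Z \<in> poly_over R" "G * H = P * Z" using dvd by (auto simp: dvd_in_def)
      define I where "I = {U * P + V * G |U V. U \<in> poly_over R \<and> V \<in> poly_over R}"
      have PI: "P \<in> I" unfolding I_def using is_subring_1[OF S] is_subring_0[OF S]
        by (intro CollectI exI[of _ 1] exI[of _ 0]) auto
      have GI: "G \<in> I" unfolding I_def using is_subring_1[OF S] is_subring_0[OF S]
        by (intro CollectI exI[of _ 0] exI[of _ 1]) auto
      have IS: "I \<subseteq> poly_over R"
        unfolding I_def by (auto intro!: is_subring_mult[OF S] is_subring_add[OF S] PS G)
      obtain w where w: "w \<in> I" "w \<noteq> 0" "\<And>y. y \<in> I \<Longrightarrow> y \<noteq> 0 \<Longrightarrow> degree w \<le> degree y"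
        using ex_has_least_nat[of "\<lambda>y. y \<in> I \<and> y \<noteq> 0" P degree] PI P0 by auto
      have wS: "w \<in> poly_over R" using w(1) IS by auto
      have div: "\<exists>c\<in>R - {0}. \<exists>Q\<in>poly_over R. smult c Y = Q * w" if Y: "Y \<in> I" for Y
      proof -
        obtain c Q r where *: "c \<in> R" "c \<noteq> 0" "Q \<in> poly_over R" "r \<in> poly_over R"
            "smult c Y = Q * w + r" "r = 0 \<or> degree r < degree w"
          using pseudo_division_over[OF R wS w(2) subsetD[OF IS Y]] by auto
        obtain U V where UV: "U \<in> poly_over R" "V \<in> poly_over R" "w = U * P + V * G"
          using w(1) by (auto simp: I_def)
        obtain U' V' where UV': "U' \<in> poly_over R" "V' \<in> poly_over R" "Y = U' * P + V' * G"
          using Y by (auto simp: I_def)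
        have "r = [:c:] * Y - Q * w" using *(5) by simp
        then have "r = ([:c:] * U' - Q * U) * P + ([:c:] * V' - Q * V) * G"
          unfolding UV(3) UV'(3) by (simp only: algebra_simps)
        moreover have "[:c:] * U' - Q * U \<in> poly_over R" "[:c:] * V' - Q * V \<in> poly_over R"
          by (intro is_subring_diff[OF S] is_subring_mult[OF S] const_in_poly_over[OF R] * UV UV')+
        ultimately have "r \<in> I" unfolding I_def by blast
        then have "r = 0" using *(6) w(3) by fastforce
        then show ?thesis using * by auto
      qed
      obtain c Q where c: "c \<in> R" "c \<noteq> 0" "Q \<in> poly_over R" "smult c P = Q * w" using div[OF PI] by blast
      obtain c' Q' where c': "c' \<in> R" "c' \<noteq> 0" "Q' \<in> poly_over R" "smult c' G = Q' * w"
        using div[OF GI] by blast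
      from strip_constant[OF ufd c(1,2) PS c(3) wS c(4)] obtain c1 c2 Q1 w1
        where *: "c1 \<in> R" "c2 \<in> R" "Q1 \<in> poly_over R" "w1 \<in> poly_over R"
          "c = c1 * c2" "Q = smult c1 Q1" "w = smult c2 w1" "P = Q1 * w1" by blast
      from P *(3,4,8) have "dvd_in (poly_over R) Q1 1 \<or> dvd_in (poly_over R) w1 1"
        unfolding irred_in_def by blast
      then show ?thesis
      proof
        assume "dvd_in (poly_over R) Q1 1"
        then obtain v where v: "v \<in> poly_over R" "1 = Q1 * v" by (auto simp: dvd_in_def)
        \<comment> \<open>Here \<open>w\<close> is \<open>P\<close> times \<open>v * [:c2:]\<close>,
          so \<open>P\<close> divides every multiple of \<open>w\<close>, in particular
          \<open>smult c' G\<close>.\<close>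
        have "P * (v * (Q' * [:c2:])) = (Q1 * v) * (Q' * ([:c2:] * w1))"
          using *(8) by (simp only: mult_ac)
        also have "\<dots> = smult c' G" unfolding v(2)[symmetric] c'(4) *(7) by simp
        finally have "smult c' G = P * (v * (Q' * [:c2:]))" by simp
        moreover have "v * (Q' * [:c2:]) \<in> poly_over R"
          by (intro is_subring_mult[OF S] const_in_poly_over[OF R] v * c')
        ultimately have "dvd_in (poly_over R) P G"
          using irred_in_strip[OF ufd P dP c'(1,2) _ G] by blast
        then show ?thesis ..
      next
        assume "dvd_in (poly_over R) w1 1"
        from unit_in_poly_over[OF R *(4) this] obtain v where v: "w1 = [:v:]" "v \<in> R" by blast
        have wc: "w = [:c2 * v:]" using * v by simp
        obtain U V where UV: "U \<in> poly_over R" "V \<in> poly_over R" "w = U * P + V * G"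
          using w(1) by (auto simp: I_def)
        \<comment> \<open>The Bezout identity for the constant \<open>w\<close> is multiplied by
          \<open>H\<close>; both summands are then multiples of \<open>P\<close>.\<close>
        have "smult (c2 * v) H = w * H" using wc by simp
        also have "\<dots> = P * (U * H) + V * (G * H)" unfolding UV(3) by (simp only: algebra_simps)
        also have "\<dots> = P * (U * H + V * Z)" unfolding Z(2) by (simp only: algebra_simps)
        finally have "smult (c2 * v) H = P * (U * H + V * Z)" .
        moreover have "U * H + V * Z \<in> poly_over R"
          by (intro is_subring_add[OF S] is_subring_mult[OF S] UV H Z)
        moreover have "c2 * v \<in> R" "c2 * v \<noteq> 0" using is_subring_mult[OF R] * v w(2) wc by auto
        ultimately have "dvd_in (poly_over R) P H"
          using irred_in_strip[OF ufd P dP _ _ _ H] by blast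
        then show ?thesis ..
      qed
    qed
    then show ?thesis using P unfolding irred_in_def prime_in_def by blast
  qed
qed

text \<open>The length of a polynomial is its degree plus the length of its leading coefficient.
  Both are additive, and length zero forces a constant that is a unit of \<open>R\<close>.\<close>

lemma ufd_on_poly_over:
  assumes ufd: "ufd_on R"
  shows "ufd_on (poly_over R)"
proof -
  have R: "is_subring R" using ufd by (simp add: ufd_on_def)
  obtain len where len: "ufd_length R len" using ufd by (auto simp: ufd_on_def)
  have lc: "lead_coeff P \<in> R - {0}" if "P \<in> poly_over R - {0}" for P
    using that by (auto simp: poly_over_def)
  have "ufd_length (poly_over R) (\<lambda>P. degree P + len (lead_coeff P))"
    unfolding ufd_length_def
  proof (intro conjI ballI impI)
    fix P Q assume PQ: "P \<in> poly_over R - {0}" "Q \<in> poly_over R - {0}"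
    then have "degree (P * Q) = degree P + degree Q" by (simp add: degree_mult_eq)
    moreover have "len (lead_coeff (P * Q)) = len (lead_coeff P) + len (lead_coeff Q)"
      unfolding lead_coeff_mult using len lc[OF PQ(1)] lc[OF PQ(2)] unfolding ufd_length_def by blast
    ultimately show "degree (P * Q) + len (lead_coeff (P * Q)) =
        degree P + len (lead_coeff P) + (degree Q + len (lead_coeff Q))" by linarith
  next
    fix P assume P: "P \<in> poly_over R - {0}" "degree P + len (lead_coeff P) = 0"
    then obtain a where a: "P = [:a:]" "a \<in> R"
      using degree_0_in_poly_over[of P R] by auto
    then have "dvd_in R a 1" using len P by (auto simp: ufd_length_def)
    then obtain b where "b \<in> R" "1 = a * b" by (auto simp: dvd_in_def)
    then show "dvd_in (poly_over R) P 1" unfolding a dvd_in_def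
      using const_in_poly_over[OF R] by (intro bexI[of _ "[:b:]"]) (auto simp: one_pCons mult.commute)
  qed
  then show ?thesis
    unfolding ufd_on_def
    using is_subring_poly_over[OF R] irred_in_imp_prime_in_poly_over[OF ufd] by blast
qed

text \<open>All conditions on \<open>h\<close> refer to \<open>R\<close> only. Evaluation of
  polynomials at \<open>Var j\<close>, to which this is applied, is injective only on polynomials
  whose coefficients avoid that variable.\<close>

lemma ufd_on_image:
  fixes h :: "'a::idom \<Rightarrow> 'b::idom"
  assumes ufd: "ufd_on R"
    and add: "\<And>a b. a \<in> R \<Longrightarrow> b \<in> R \<Longrightarrow> h (a + b) = h a + h b"
    and mult: "\<And>a b. a \<in> R \<Longrightarrow> b \<in> R \<Longrightarrow> h (a * b) = h a * h b"
    and one: "h 1 = 1" and inj: "\<And>a. a \<in> R \<Longrightarrow> h a = 0 \<Longrightarrow> a = 0"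
  shows "ufd_on (h ` R)"
proof -
  have R: "is_subring R" using ufd by (simp add: ufd_on_def)
  obtain len where len: "ufd_length R len" using ufd by (auto simp: ufd_on_def)
  have "h 0 + h 0 = h 0 + 0" using add[OF is_subring_0[OF R] is_subring_0[OF R]] by simp
  then have zero: "h 0 = 0" by (rule add_left_imp_eq)
  have diff: "h (a - b) = h a - h b" if "a \<in> R" "b \<in> R" for a b
    using add[OF is_subring_diff[OF R that] that(2)] by simp
  have inj': "a = b" if "a \<in> R" "b \<in> R" "h a = h b" for a b
    using inj[OF is_subring_diff[OF R that(1,2)]] diff that by simp
  have S: "is_subring (h ` R)"
    unfolding is_subring_def
  proof (intro conjI ballI)
    show "0 \<in> h ` R" "1 \<in> h ` R"
      using zero one is_subring_0[OF R] is_subring_1[OF R] by (metis imageI)+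
    fix x y assume "x \<in> h ` R" "y \<in> h ` R"
    then obtain a b where ab: "a \<in> R" "b \<in> R" "x = h a" "y = h b" by auto
    show "x + y \<in> h ` R" "x - y \<in> h ` R" "x * y \<in> h ` R"
      unfolding ab(3,4) add[OF ab(1,2), symmetric] mult[OF ab(1,2), symmetric] diff[OF ab(1,2), symmetric]
      using is_subring_add[OF R ab(1,2)] is_subring_diff[OF R ab(1,2)] is_subring_mult[OF R ab(1,2)]
      by simp_all
  qed
  have dvd: "dvd_in (h ` R) (h a) (h b) \<longleftrightarrow> dvd_in R a b" if "a \<in> R" "b \<in> R" for a b
  proof
    assume "dvd_in (h ` R) (h a) (h b)"
    then obtain c where c: "c \<in> R" "h b = h a * h c" by (auto simp: dvd_in_def)
    then have "h b = h (a * c)" using mult that by simp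
    then have "b = a * c" using inj' that c is_subring_mult[OF R] by blast
    then show "dvd_in R a b" using c by (auto simp: dvd_in_def)
  next
    assume "dvd_in R a b" then show "dvd_in (h ` R) (h a) (h b)"
      using mult that by (auto simp: dvd_in_def)
  qed
  have dvd1: "dvd_in (h ` R) (h a) 1 \<longleftrightarrow> dvd_in R a 1" if "a \<in> R" for a
    using dvd[OF that is_subring_1[OF R]] one by simp
  have h0: "h a = 0 \<longleftrightarrow> a = 0" if "a \<in> R" for a using inj[OF that] zero by auto
  define g where "g = the_inv_into R h"
  have g: "g (h a) = a" if "a \<in> R" for a
    unfolding g_def by (rule the_inv_into_f_f[OF inj_onI that]) (use inj' in blast)
  have "ufd_length (h ` R) (\<lambda>x. len (g x))"
    unfolding ufd_length_def
  proof (intro conjI ballI impI)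
    fix x y assume "x \<in> h ` R - {0}" "y \<in> h ` R - {0}"
    then obtain a b where ab: "x = h a" "y = h b" "a \<in> R" "b \<in> R" "a \<noteq> 0" "b \<noteq> 0"
      using h0 by auto
    have "g (x * y) = a * b" using ab mult[symmetric] g is_subring_mult[OF R] by simp
    then show "len (g (x * y)) = len (g x) + len (g y)"
      using ab g len by (auto simp: ufd_length_def)
  next
    fix x assume x: "x \<in> h ` R - {0}" "len (g x) = 0"
    then obtain a where a: "x = h a" "a \<in> R" "a \<noteq> 0" using h0 by auto
    then have "dvd_in R a 1" using x g len by (auto simp: ufd_length_def)
    then show "dvd_in (h ` R) x 1" using a dvd1 by simp
  qed
  moreover have "prime_in (h ` R) q" if "irred_in (h ` R) q" for q
  proof -
    have "q \<in> h ` R" using that by (simp add: irred_in_def)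
    then obtain a where a: "q = h a" "a \<in> R" by auto
    have "irred_in R a"
      unfolding irred_in_def
    proof (intro conjI ballI impI)
      show "a \<in> R" "a \<noteq> 0" "\<not> dvd_in R a 1" using that a dvd1 h0 by (auto simp: irred_in_def)
      fix b c assume bc: "b \<in> R" "c \<in> R" "a = b * c"
      then have "q = h b * h c" using a mult by simp
      then have "dvd_in (h ` R) (h b) 1 \<or> dvd_in (h ` R) (h c) 1"
 using that bc(1,2) unfolding irred_in_def by blast
      then show "dvd_in R b 1 \<or> dvd_in R c 1" using dvd1 bc by blast
    qed
    then have "prime_in R a" using ufd unfolding ufd_on_def by blast
    show ?thesis
      unfolding prime_in_def a(1)
    proof (intro conjI ballI impI)
      show "h a \<in> h ` R" "h a \<noteq> 0" "\<not> dvd_in (h ` R) (h a) 1"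
        using \<open>prime_in R a\<close> a(2) h0 dvd1 by (auto simp: prime_in_def)
      fix x y assume xy: "x \<in> h ` R" "y \<in> h ` R" "dvd_in (h ` R) (h a) (x * y)"
      then obtain b c where bc: "b \<in> R" "c \<in> R" "x = h b" "y = h c" by auto
      have "dvd_in (h ` R) (h a) (h (b * c))" using xy(3) bc mult by simp
      then have "dvd_in R a (b * c)" using dvd a(2) is_subring_mult[OF R bc(1,2)] by blast
      then have "dvd_in R a b \<or> dvd_in R a c"
        using \<open>prime_in R a\<close> bc unfolding prime_in_def by blast
      then show "dvd_in (h ` R) (h a) x \<or> dvd_in (h ` R) (h a) y"
        using dvd a(2) bc by blast
    qed
  qed
  ultimately show ?thesis using S unfolding ufd_on_def by blast
qed

section \<open>Unique factorization of polynomials in several variables\<close>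

lemma ufd_on_UNIV: "ufd_on (UNIV :: 'a::{idom, factorial_semiring} set)"
proof -
  have "ufd_length (UNIV :: 'a set) (\<lambda>a. size (prime_factorization a))"
    by (auto simp: ufd_length_def prime_factorization_mult prime_factorization_empty_iff dvd_in_def
      elim!: dvdE intro: sym)
  moreover have "prime_in UNIV q" if "irred_in UNIV q" for q :: 'a
  proof -
    have dvd: "dvd_in (UNIV :: 'a set) = (dvd)" by (auto simp: fun_eq_iff dvd_in_def)
    have "irreducible q"
      using that unfolding irred_in_def dvd by (intro irreducibleI) auto
    then have "prime_elem q" by (rule irreducible_imp_prime_elem)
    then show ?thesis unfolding prime_in_def dvd prime_elem_def by auto
  qed
  ultimately show ?thesis by (auto simp: ufd_on_def is_subring_def)
qed

text \<open>For growing \<open>V\<close> these subrings play the role of the iterated polynomial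
  rings K[x_1]...[x_k].\<close>

definition polys_in :: "'n set \<Rightarrow> ('n, 'k::comm_ring_1) mpoly set" where
  "polys_in V = {f. \<forall>m\<in>Poly_Mapping.keys f. Poly_Mapping.keys m \<subseteq> V}"

lemma polys_in_iff:
  "f \<in> polys_in V \<longleftrightarrow>
     (\<forall>m i. Poly_Mapping.lookup f m \<noteq> 0 \<longrightarrow> Poly_Mapping.lookup m i \<noteq> 0 \<longrightarrow> i \<in> V)"
  by (auto simp: polys_in_def in_keys_iff subset_iff)

lemma lookup_single_mult_add:
  fixes f :: "('n, 'k::comm_ring_1) mpoly"
  shows "Poly_Mapping.lookup (Poly_Mapping.single t c * f) (t + m) = c * Poly_Mapping.lookup f m"
  by (simp add: lookup_mult lookup_single when_mult)

lemma lookup_single_mult_eq_0: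
  fixes f :: "('n, 'k::comm_ring_1) mpoly"
  assumes "\<And>k. m \<noteq> t + k"
  shows "Poly_Mapping.lookup (Poly_Mapping.single t c * f) m = 0"
  using assms by (simp add: lookup_mult lookup_single when_mult)

lemma mpoly_eq_sum_single:
  "f = (\<Sum>m\<in>Poly_Mapping.keys f. Poly_Mapping.single m (Poly_Mapping.lookup f m))"
  by (rule poly_mapping_eqI) (simp add: lookup_sum lookup_single when_def in_keys_iff)

lemma Var_power: "Var j ^ k = Poly_Mapping.single (Poly_Mapping.single j k) (1 :: 'k::comm_ring_1)"
proof (induction k)
  case (Suc k)
  then show ?case
    by (simp add: Var_def mult_single single_add[symmetric] del: single_add)
qed (simp)

lemma Const_simps [simp]:
  "Const 0 = 0" "Const 1 = 1" "Const (a + b) = Const a + Const b" "Const (a - b) = Const a - Const b"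
  "Const (a * b) = Const a * Const b" "Const (- a) = - Const a"
  by (simp_all add: Const_def single_add single_diff mult_single single_uminus)

lemma Const_eq_0_iff [simp]: "Const a = 0 \<longleftrightarrow> a = 0"
  by (metis Const_def lookup_single_eq lookup_zero single_zero)

lemma is_subring_polys_in:
  "is_subring (polys_in V :: ('n::linorder, 'k::idom) mpoly set)"
  unfolding is_subring_def
proof (intro conjI ballI)
  show "0 \<in> polys_in V" "1 \<in> polys_in V" by (auto simp: polys_in_def)
  fix f g :: "('n, 'k) mpoly" assume fg: "f \<in> polys_in V" "g \<in> polys_in V"
  show "f + g \<in> polys_in V" using fg keys_add[of f g] by (auto simp: polys_in_def)
  show "f - g \<in> polys_in V" using fg unfolding polys_in_iff by (metis diff_self lookup_minus)
  show "f * g \<in> polys_in V"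
    unfolding polys_in_def
  proof (intro CollectI ballI)
    fix m assume "m \<in> Poly_Mapping.keys (f * g)"
    then obtain a b where "m = a + b" "a \<in> Poly_Mapping.keys f" "b \<in> Poly_Mapping.keys g"
      using keys_mult[of f g] by auto
    then show "Poly_Mapping.keys m \<subseteq> V"
      using fg keys_add[of a b] unfolding polys_in_def by blast
  qed
qed

lemma polys_in_empty: "polys_in {} = range (Const :: 'k::comm_ring_1 \<Rightarrow> ('n, 'k) mpoly)"
proof
  show "range Const \<subseteq> polys_in {}" by (auto simp: polys_in_def Const_def split: if_splits)
  show "polys_in {} \<subseteq> range (Const :: 'k \<Rightarrow> ('n, 'k) mpoly)"
  proof
    fix f :: "('n, 'k) mpoly" assume f: "f \<in> polys_in {}"
    have "Poly_Mapping.lookup f m = Poly_Mapping.lookup (Const (Poly_Mapping.lookup f 0)) m" for m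
      using f by (auto simp: Const_def lookup_single when_def polys_in_def in_keys_iff)
    then show "f \<in> range Const" using poly_mapping_eqI by blast
  qed
qed

text \<open>The constant coefficient is a multiple of \<open>Var j\<close> although that variable
  does not occur in it, so it vanishes. Cancelling \<open>Var j\<close> leaves a polynomial with
  fewer coefficients.\<close>

lemma eval_at_Var_inj:
  fixes P :: "('n::linorder, 'k::idom) mpoly poly"
  assumes j: "j \<notin> V" and "P \<in> poly_over (polys_in V)" "poly P (Var j) = 0"
  shows "P = 0"
  using assms(2,3)
proof (induction P)
  case (pCons a P)
  have a: "a \<in> polys_in V" and P: "P \<in> poly_over (polys_in V)"
    using pCons.prems(1) unfolding poly_over_def
    by (auto dest: spec[of _ 0] intro: allI) (metis coeff_pCons_Suc)
  have eq: "a = - (Var j * poly P (Var j))"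
    using pCons.prems(2) by (simp add: eq_neg_iff_add_eq_0)
  have "Poly_Mapping.lookup a m = 0" for m
  proof (cases "j \<in> Poly_Mapping.keys m")
    case True
    then show ?thesis using a j by (auto simp: polys_in_iff in_keys_iff)
  next
    case False
    have "m \<noteq> Poly_Mapping.single j 1 + k" for k
      using False by (auto simp: in_keys_iff lookup_add)
    then show ?thesis unfolding eq by (simp add: Var_def lookup_single_mult_eq_0)
  qed
  then have "a = 0" by (intro poly_mapping_eqI) simp
  moreover have "Var j \<noteq> (0 :: ('n, 'k) mpoly)"
    by (metis Var_def lookup_single_eq lookup_zero zero_neq_one)
  ultimately have "poly P (Var j) = 0" using eq by simp
  then show ?case using pCons.IH[OF P] \<open>a = 0\<close> by simp
qed simp

text \<open>Ordering a polynomial by powers of \<open>Var j\<close> identifies K[V, x_j] with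
  K[V][T]; this carries the induction on the variables.\<close>

lemma polys_in_insert:
  assumes j: "j \<notin> V"
  shows "polys_in (insert j V) =
    (\<lambda>P. poly P (Var j)) ` poly_over (polys_in V :: ('n::linorder, 'k::idom) mpoly set)"
proof
  note R = is_subring_polys_in[of V, where ?'k = 'k]
  note R' = is_subring_polys_in[of "insert j V", where ?'k = 'k]
  note S = is_subring_poly_over[OF R]
  have Var: "Var j \<in> polys_in (insert j V)" by (auto simp: polys_in_def Var_def)
  have "poly P (Var j) \<in> polys_in (insert j V)" if "P \<in> poly_over (polys_in V)"
    for P :: "('n, 'k) mpoly poly"
  proof -
    have "coeff P i \<in> polys_in (insert j V)" for i
      using that by (auto simp: poly_over_def polys_in_def)
    then show ?thesis
    proof (induction P)
      case (pCons a P)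
      have "a \<in> polys_in (insert j V)" using pCons.prems[of 0] by simp
      moreover have "poly P (Var j) \<in> polys_in (insert j V)"
        using pCons.IH pCons.prems by (metis coeff_pCons_Suc)
      ultimately show ?case
        using is_subring_add[OF R'] is_subring_mult[OF R' Var] by simp
    qed (simp add: is_subring_0[OF R'])
  qed
  then show "(\<lambda>P. poly P (Var j)) ` poly_over (polys_in V) \<subseteq>
      (polys_in (insert j V) :: ('n, 'k) mpoly set)" by blast
  show "polys_in (insert j V) \<subseteq> (\<lambda>P. poly P (Var j)) ` poly_over (polys_in V :: ('n, 'k) mpoly set)"
  proof
    fix f :: "('n, 'k) mpoly" assume f: "f \<in> polys_in (insert j V)"
    \<comment> \<open>The term at \<open>m\<close>, with its power of \<open>Var j\<close> turned
      into a power of the outer indeterminate.\<close>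
    define Q where "Q m = monom (Poly_Mapping.single (m - Poly_Mapping.single j (Poly_Mapping.lookup m j))
        (Poly_Mapping.lookup f m)) (Poly_Mapping.lookup m j)" for m
    have QS: "Q m \<in> poly_over (polys_in V)" if "m \<in> Poly_Mapping.keys f" for m
    proof -
      have "Poly_Mapping.keys (m - Poly_Mapping.single j (Poly_Mapping.lookup m j)) \<subseteq> V"
      proof
        fix x assume "x \<in> Poly_Mapping.keys (m - Poly_Mapping.single j (Poly_Mapping.lookup m j))"
        then have "x \<noteq> j" "x \<in> Poly_Mapping.keys m"
          by (auto simp: in_keys_iff lookup_minus lookup_single when_def split: if_splits)
        then show "x \<in> V" using f that by (auto simp: polys_in_def)
      qed
      then show ?thesis
        using is_subring_0[OF R] by (auto simp: Q_def poly_over_def polys_in_def split: if_splits)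
    qed
    have "poly (Q m) (Var j) = Poly_Mapping.single m (Poly_Mapping.lookup f m)" for m
    proof -
      have "m - Poly_Mapping.single j (Poly_Mapping.lookup m j) + Poly_Mapping.single j (Poly_Mapping.lookup m j) = m"
        by (rule poly_mapping_eqI) (simp add: lookup_add lookup_minus lookup_single when_def)
      then show ?thesis by (simp add: Q_def poly_monom Var_power mult_single)
    qed
    then have "poly (\<Sum>m\<in>Poly_Mapping.keys f. Q m) (Var j) =
        (\<Sum>m\<in>Poly_Mapping.keys f. Poly_Mapping.single m (Poly_Mapping.lookup f m))"
      by (simp add: poly_sum)
    also have "\<dots> = f" by (rule mpoly_eq_sum_single[symmetric])
    finally have "f = poly (\<Sum>m\<in>Poly_Mapping.keys f. Q m) (Var j)" ..
    moreover have "(\<Sum>m\<in>Poly_Mapping.keys f. Q m) \<in> poly_over (polys_in V)"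
      using QS by (intro is_subring_sum[OF S])
    ultimately show "f \<in> (\<lambda>P. poly P (Var j)) ` poly_over (polys_in V)" by blast
  qed
qed

text \<open>Induction on \<open>V\<close>. The units are determined along the way: evaluation at the
  new variable is injective, and units of a polynomial ring over a domain are units of the
  coefficient ring, so only constants remain.\<close>

lemma ufd_on_polys_in:
  fixes V :: "'n::linorder set"
  assumes "finite V"
  shows "ufd_on (polys_in V :: ('n, 'k::{idom, factorial_semiring}) mpoly set) \<and>
    (\<forall>u. dvd_in (polys_in V) u (1 :: ('n, 'k) mpoly) \<longrightarrow> u \<in> polys_in V \<longrightarrow> u \<in> range Const)"
  using assms
proof induction
  case empty
  have "ufd_on (range (Const :: 'k \<Rightarrow> ('n, 'k) mpoly))"
    by (rule ufd_on_image[OF ufd_on_UNIV]) simp_all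
  then show ?case by (simp add: polys_in_empty)
next
  case (insert j V)
  let ?R = "polys_in V :: ('n, 'k) mpoly set" and ?h = "\<lambda>P :: ('n, 'k) mpoly poly. poly P (Var j)"
  note R = is_subring_polys_in[of V, where ?'k = 'k]
  have inj: "P = 0" if "P \<in> poly_over ?R" "?h P = 0" for P
    using eval_at_Var_inj[OF insert.hyps(2) that] .
  have "ufd_on (poly_over ?R)" using insert.IH by (intro ufd_on_poly_over) simp
  then have "ufd_on (?h ` poly_over ?R)"
    by (rule ufd_on_image) (use inj in simp_all)
  moreover have "u \<in> range Const"
    if u: "dvd_in (polys_in (insert j V)) u (1 :: ('n, 'k) mpoly)" "u \<in> polys_in (insert j V)" for u
  proof -
    obtain P where P: "P \<in> poly_over ?R" "u = ?h P"
      using u(2) unfolding polys_in_insert[OF insert.hyps(2)] by blast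
    obtain Q where Q: "Q \<in> poly_over ?R" "1 = u * ?h Q"
      using u(1) unfolding polys_in_insert[OF insert.hyps(2)] dvd_in_def by blast
    have "?h (P * Q - 1) = 0" using P(2) Q(2) by simp
    moreover have "P * Q - 1 \<in> poly_over ?R"
      using is_subring_poly_over[OF R] P Q by (intro is_subring_diff is_subring_mult is_subring_1) simp_all
    ultimately have "1 = P * Q" using inj by fastforce
    then have "dvd_in (poly_over ?R) P 1" using Q(1) by (auto simp: dvd_in_def)
    then obtain v where v: "P = [:v:]" "v \<in> ?R" "dvd_in ?R v 1"
      using unit_in_poly_over[OF R P(1)] by metis
    then show ?thesis using insert.IH P(2) by simp
  qed
  ultimately show ?case by (simp add: polys_in_insert[OF insert.hyps(2)])
qed

section \<open>Coprime families of polynomials\<close>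

lemma dvd_in_UNIV: "dvd_in UNIV a b \<longleftrightarrow> a dvd b"
  by (auto simp: dvd_in_def)

lemma mpoly_unit_const:
  fixes u :: "('n::{finite, linorder}, 'k::{idom, factorial_semiring}) mpoly"
  assumes "u dvd 1"
  obtains a where "u = Const a"
  using ufd_on_polys_in[OF finite[of "UNIV :: 'n set"], where ?'k = 'k] assms that
  by (auto simp: polys_in_def dvd_in_UNIV)

lemma ufd_on_mpoly:
  "ufd_on (UNIV :: ('n::{finite, linorder}, 'k::{idom, factorial_semiring}) mpoly set)"
  using ufd_on_polys_in[OF finite[of "UNIV :: 'n set"], where ?'k = 'k] by (simp add: polys_in_def)

lemma prime_in_UNIV: "prime_in UNIV q \<longleftrightarrow> prime_elem q"
  by (auto simp: prime_in_def dvd_in_UNIV prime_elem_def)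

lemma mpoly_prime_factor_exists:
  fixes h :: "('n::{finite, linorder}, 'k::{idom, factorial_semiring}) mpoly"
  assumes "h \<noteq> 0" "\<not> h dvd 1"
  obtains q where "prime_elem q" "q dvd h"
proof -
  obtain len :: "('n, 'k) mpoly \<Rightarrow> nat" where len: "ufd_length UNIV len"
    and irr: "\<And>q :: ('n, 'k) mpoly. irred_in UNIV q \<Longrightarrow> prime_in UNIV q"
    using ufd_on_mpoly[where ?'n = 'n and ?'k = 'k] unfolding ufd_on_def by blast
  obtain q b where "prime_elem q" "h = q * b"
    using prime_factor_exists_in[OF len _ irr UNIV_I assms(1)] assms(2)
    by (auto simp: prime_in_UNIV dvd_in_UNIV is_subring_def)
  then show ?thesis using that by auto
qed

text \<open>Says that the gcd is a unit without selecting one of the associated gcds.\<close>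

definition coprime_set :: "'a::comm_semiring_1 set \<Rightarrow> bool" where
  "coprime_set S \<longleftrightarrow> (\<forall>h. (\<forall>s\<in>S. h dvd s) \<longrightarrow> h dvd 1)"

text \<open>A prime \<open>q\<close> dividing \<open>b\<close> fails to divide some \<open>s\<close>
  in \<open>S\<close>, hence divides \<open>h\<close>; cancel \<open>q\<close> and continue. For
  \<open>b = 0\<close> it suffices that \<open>S\<close> has a nonzero element. That case later
  yields linear independence.\<close>

lemma dvd_of_coprime_set:
  fixes b h :: "('n::{finite, linorder}, 'k::{idom, factorial_semiring}) mpoly"
  assumes S: "coprime_set S" and dvd: "\<And>s. s \<in> S \<Longrightarrow> b dvd s * h"
  shows "b dvd h"
proof (cases "b = 0")
  case True
  have "h = 0"
  proof (rule ccontr)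
    assume "h \<noteq> 0"
    then have "\<forall>s\<in>S. 0 dvd s" using dvd True by auto
    then have "(0 :: ('n, 'k) mpoly) dvd 1" using S unfolding coprime_set_def by blast
    then show False by simp
  qed
  then show ?thesis by simp
next
  case False
  show ?thesis
    using ufd_on_mpoly UNIV_I False dvd
  proof (induction b arbitrary: h rule: ufd_on_induct)
    case (unit u)
    then show ?case by (simp add: dvd_in_UNIV unit_imp_dvd)
  next
    case (prime q b)
    have q: "prime_elem q" using prime.hyps by (simp add: prime_in_UNIV)
    then have q1: "\<not> q dvd 1" "q \<noteq> 0" unfolding prime_elem_def by blast+
    then obtain s where s: "s \<in> S" "\<not> q dvd s"
      using S q1(1) unfolding coprime_set_def by blast
    have "q dvd s * h" using prime.prems[OF s(1)] by (rule dvd_mult_left)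
    then have "q dvd h" using s(2) prime_elem_dvd_multD[OF q] by blast
    then obtain h' where h': "h = q * h'" ..
    have "b dvd s * h'" if "s \<in> S" for s
    proof -
      have "q * b dvd q * (s * h')" using prime.prems[OF that] by (simp add: h' mult_ac)
      then show ?thesis using q1(2) by simp
    qed
    then have "b dvd h'" by (rule prime.IH)
    then show ?case unfolding h' by (rule mult_dvd_mono[OF dvd_refl])
  qed
qed

section \<open>Derivations and the subring of polynomials in p-th powers\<close>

lemma partial_deriv_lookup:
  fixes f :: "('n, 'k::comm_ring_1) mpoly"
  shows "Poly_Mapping.lookup (partial_deriv j f) m =
    of_nat (Poly_Mapping.lookup m j + 1) * Poly_Mapping.lookup f (m + Poly_Mapping.single j 1)"
proof -
  let ?s = "Poly_Mapping.single j (1 :: nat)"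
  let ?F = "\<lambda>e. of_nat (Poly_Mapping.lookup e j) * Poly_Mapping.lookup f e"
  \<comment> \<open>Truncated subtraction can send two exponents to the same \<open>m\<close>, but
    the unwanted one has exponent \<open>0\<close> at \<open>j\<close> and carries the factor
    \<open>0\<close>.\<close>
  have eq: "(?F e when e - ?s = m) = (if e = m + ?s then ?F e else 0)" for e
  proof (cases "Poly_Mapping.lookup e j = 0")
    case True
    then show ?thesis by auto
  next
    case False
    have "e - ?s = m \<longleftrightarrow> e = m + ?s"
    proof
      assume "e - ?s = m"
      then show "e = m + ?s"
        using False by (auto intro!: poly_mapping_eqI simp: lookup_add lookup_minus lookup_single when_def)
    qed simp
    then show ?thesis by (simp add: when_def)
  qed
  have "Poly_Mapping.lookup (partial_deriv j f) m =
      (\<Sum>e\<in>Poly_Mapping.keys f. if e = m + ?s then ?F e else 0)"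
    by (simp only: partial_deriv_def lookup_sum lookup_single eq)
  also have "\<dots> = (if m + ?s \<in> Poly_Mapping.keys f then ?F (m + ?s) else 0)"
    by (simp add: sum.delta)
  also have "\<dots> = ?F (m + ?s)" by (auto simp: in_keys_iff)
  finally show ?thesis by (simp add: lookup_add)
qed

lemma partial_deriv_single:
  "partial_deriv j (Poly_Mapping.single t c :: ('n, 'k::comm_ring_1) mpoly) =
    Poly_Mapping.single (t - Poly_Mapping.single j 1) (of_nat (Poly_Mapping.lookup t j) * c)"
  by (cases "c = 0") (simp_all add: partial_deriv_def)

lemma partial_deriv_add: "partial_deriv j (f + g) = partial_deriv j f + partial_deriv j g"
  by (rule poly_mapping_eqI) (simp add: partial_deriv_lookup lookup_add distrib_left)

lemma partial_deriv_sum: "partial_deriv j (sum f A) = (\<Sum>a\<in>A. partial_deriv j (f a))"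
proof (induction A rule: infinite_finite_induct)
  case empty show ?case by (simp add: partial_deriv_def)
next
  case infinite then show ?case by (simp add: partial_deriv_def)
qed (simp add: partial_deriv_add)

lemma partial_deriv_mult_single:
  "partial_deriv j (Poly_Mapping.single t c * Poly_Mapping.single s c') =
     partial_deriv j (Poly_Mapping.single t c) * Poly_Mapping.single s c' +
     Poly_Mapping.single t c * partial_deriv j (Poly_Mapping.single s (c' :: 'k::comm_ring_1))"
proof -
  let ?e = "Poly_Mapping.single j (1 :: nat)"
  have 1: "Poly_Mapping.single (t - ?e + s) (of_nat (Poly_Mapping.lookup t j) * c * c') =
      Poly_Mapping.single (t + s - ?e) (of_nat (Poly_Mapping.lookup t j) * c * c')"
  proof (cases "Poly_Mapping.lookup t j = 0")
    case False
    then have "t - ?e + s = t + s - ?e"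
      by (auto intro!: poly_mapping_eqI simp: lookup_add lookup_minus lookup_single when_def)
    then show ?thesis by simp
  qed simp
  have 2: "Poly_Mapping.single (t + (s - ?e)) (c * (of_nat (Poly_Mapping.lookup s j) * c')) =
      Poly_Mapping.single (t + s - ?e) (c * (of_nat (Poly_Mapping.lookup s j) * c'))"
  proof (cases "Poly_Mapping.lookup s j = 0")
    case False
    then have "t + (s - ?e) = t + s - ?e"
      by (auto intro!: poly_mapping_eqI simp: lookup_add lookup_minus lookup_single when_def)
    then show ?thesis by simp
  qed simp
  show ?thesis
    unfolding mult_single partial_deriv_single 1 2 single_add[symmetric] lookup_add
    by (simp add: algebra_simps)
qed

lemma partial_deriv_mult:
  fixes f g :: "('n, 'k::comm_ring_1) mpoly"
  shows "partial_deriv j (f * g) = partial_deriv j f * g + f * partial_deriv j g"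
proof -
  \<comment> \<open>A property that holds for monomials and passes to sums holds for all
    polynomials. It reduces the product rule to monomials, first in \<open>g\<close> and then in
    \<open>f\<close>.\<close>
  have expand: "P f" if add: "\<And>A (F :: ('n \<Rightarrow>\<^sub>0 nat) \<Rightarrow> ('n, 'k) mpoly). (\<And>a. a \<in> A \<Longrightarrow> P (F a)) \<Longrightarrow> P (sum F A)"
    and "\<And>t c. P (Poly_Mapping.single t c)" for P and f :: "('n, 'k) mpoly"
    using add[of "Poly_Mapping.keys f" "\<lambda>m. Poly_Mapping.single m (Poly_Mapping.lookup f m)"] that(2)
    by (simp only: mpoly_eq_sum_single[symmetric])
  have 1: "partial_deriv j (Poly_Mapping.single t c * g) =
      partial_deriv j (Poly_Mapping.single t c) * g + Poly_Mapping.single t c * partial_deriv j g" for t c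
    by (rule expand[of _ g])
      (simp_all only: sum_distrib_left partial_deriv_sum sum.distrib[symmetric]
        partial_deriv_mult_single cong: sum.cong)
  show ?thesis
    by (rule expand[of _ f])
      (simp_all only: sum_distrib_right partial_deriv_sum sum.distrib[symmetric] 1 cong: sum.cong)
qed

lemma Const_mult_lookup: "Poly_Mapping.lookup (Const c * f) m = c * Poly_Mapping.lookup f m"
  using lookup_single_mult_add[of 0 c f m] by (simp add: Const_def)

lemma K_derivation_partial_deriv:
  "K_derivation (partial_deriv j :: ('n, 'k::comm_ring_1) mpoly \<Rightarrow> _)"
  unfolding K_derivation_def
proof (intro conjI allI)
  fix c and f :: "('n, 'k) mpoly"
  show "partial_deriv j (Const c * f) = Const c * partial_deriv j f"
    by (rule poly_mapping_eqI) (simp only: partial_deriv_lookup Const_mult_lookup mult.left_commute)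
qed (simp_all add: partial_deriv_add partial_deriv_mult)

lemma partial_deriv_Var: "partial_deriv l (Var j) = (if l = j then 1 else 0)"
  by (auto simp: Var_def partial_deriv_single lookup_single when_def)

context
  fixes d :: "('n, 'k::comm_ring_1) mpoly \<Rightarrow> ('n, 'k) mpoly"
  assumes d: "K_derivation d"
begin

lemma K_derivation_add: "d (f + g) = d f + d g"
  and K_derivation_mult: "d (f * g) = d f * g + f * d g"
  and K_derivation_scale: "d (Const c * f) = Const c * d f"
  using d unfolding K_derivation_def by blast+

lemma K_derivation_0: "d 0 = 0"
  using K_derivation_add[of 0 0] by simp

lemma K_derivation_sum: "d (sum F A) = (\<Sum>a\<in>A. d (F a))"
  by (induction A rule: infinite_finite_induct) (simp_all add: K_derivation_0 K_derivation_add)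

lemma K_derivation_1: "d 1 = 0"
  using K_derivation_mult[of 1 1] by simp

lemma K_derivation_Const: "d (Const c) = 0"
  using K_derivation_scale[of c 1] by (simp add: K_derivation_1)

lemma K_derivation_uminus: "d (- f) = - d f"
  using K_derivation_add[of f "- f"] by (simp add: K_derivation_0 eq_neg_iff_add_eq_0 add.commute)

lemma K_derivation_diff: "d (f - g) = d f - d g"
  using K_derivation_add[of f "- g"] by (simp add: K_derivation_uminus)

lemma K_derivation_power: "d (f ^ k) = of_nat k * f ^ (k - 1) * d f"
proof (induction k)
  case (Suc k)
  have "f * (of_nat k * f ^ (k - 1) * d f) = of_nat k * f ^ k * d f"
    by (cases k) (simp_all add: mult_ac)
  then show ?case by (simp add: K_derivation_mult Suc algebra_simps)
qed (simp add: K_derivation_1)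

lemma K_derivation_prod_0: "(\<And>a. a \<in> A \<Longrightarrow> d (F a) = 0) \<Longrightarrow> d (prod F A) = 0"
  by (induction A rule: infinite_finite_induct) (simp_all add: K_derivation_1 K_derivation_mult)

lemma K_derivation_power_0: "d f = 0 \<Longrightarrow> d (f ^ k) = 0"
  by (simp add: K_derivation_power)

end

lemma of_nat_mpoly: "of_nat m = (Const (of_nat m) :: ('n, 'k::comm_ring_1) mpoly)"
  by (induction m) simp_all

lemma K_derivation_power_CHAR:
  fixes d :: "('n, 'k::comm_ring_1) mpoly \<Rightarrow> ('n, 'k) mpoly"
  assumes "K_derivation d" "CHAR('k) = p"
  shows "d (f ^ p) = 0"
  using K_derivation_power[OF assms(1), of f p] assms(2) by (auto simp: of_nat_mpoly)

section \<open>The subring of polynomials in the p-th powers of the variables\<close>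

lemma prod_single:
  "(\<Prod>i\<in>A. Poly_Mapping.single (t i) (1 :: 'k::comm_ring_1)) = Poly_Mapping.single (\<Sum>i\<in>A. t i) 1"
  by (induction A rule: infinite_finite_induct) (simp_all add: mult_single)

lemma single_eq_prod_Var:
  "Poly_Mapping.single m c = Const c * (\<Prod>i\<in>(UNIV :: 'n::finite set). Var i ^ Poly_Mapping.lookup m i)"
proof -
  have "(\<Sum>i\<in>UNIV. Poly_Mapping.single i (Poly_Mapping.lookup m i)) = m"
    by (rule poly_mapping_eqI) (simp add: lookup_sum lookup_single when_def)
  then show ?thesis by (simp add: Var_power prod_single Const_def mult_single)
qed

text \<open>The ring \<open>B\<close> of the overview. Its coefficients range over the whole of K,
  not only over p-th powers.\<close>

abbreviation pow_subalg :: "nat \<Rightarrow> ('n, 'k::comm_ring_1) mpoly set" where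
  "pow_subalg p \<equiv> generated_subalgebra (range (\<lambda>j. Var j ^ p))"

lemma generated_subalgebra_prod:
  "(\<And>a. a \<in> A \<Longrightarrow> F a \<in> generated_subalgebra S) \<Longrightarrow> prod F A \<in> generated_subalgebra S"
  by (induction A rule: infinite_finite_induct)
     (auto intro: generated_subalgebra.intros generated_subalgebra.const[of 1, simplified])

lemma generated_subalgebra_sum:
  "(\<And>a. a \<in> A \<Longrightarrow> F a \<in> generated_subalgebra S) \<Longrightarrow> sum F A \<in> generated_subalgebra S"
  by (induction A rule: infinite_finite_induct)
     (auto intro: generated_subalgebra.intros generated_subalgebra.const[of 0, simplified])

lemma generated_subalgebra_power:
  "f \<in> generated_subalgebra S \<Longrightarrow> f ^ k \<in> generated_subalgebra S"
  using generated_subalgebra_prod[of "{..<k}" "\<lambda>_. f" S] by simp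

lemma is_subring_generated_subalgebra:
  "is_subring (generated_subalgebra S :: ('n::linorder, 'k::idom) mpoly set)"
  unfolding is_subring_def
proof (intro conjI ballI)
  show "0 \<in> generated_subalgebra S" "1 \<in> generated_subalgebra S"
    using generated_subalgebra.const[of 0 S] generated_subalgebra.const[of 1 S] by simp_all
  fix f g assume fg: "f \<in> generated_subalgebra S" "g \<in> generated_subalgebra S"
  show "f + g \<in> generated_subalgebra S" "f * g \<in> generated_subalgebra S"
    by (rule generated_subalgebra.intros fg)+
  have "f + Const (- 1) * g \<in> generated_subalgebra S"
    by (rule generated_subalgebra.intros fg)+
  moreover have "f + Const (- 1) * g = f - g" unfolding Const_simps by simp
  ultimately show "f - g \<in> generated_subalgebra S" by metis
qed

text \<open>Turns membership into a condition on exponents, so that a polynomial can be split into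
  its part in the subring and the rest.\<close>

lemma pow_subalg_iff:
  fixes f :: "('n::finite, 'k::comm_ring_1) mpoly"
  shows "f \<in> pow_subalg p \<longleftrightarrow> (\<forall>m\<in>Poly_Mapping.keys f. \<forall>i. p dvd Poly_Mapping.lookup m i)"
proof
  assume "f \<in> pow_subalg p"
  then show "\<forall>m\<in>Poly_Mapping.keys f. \<forall>i. p dvd Poly_Mapping.lookup m i"
  proof induction
    case (const c)
    then show ?case by (simp add: Const_def)
  next
    case (gen s)
    then show ?case by (auto simp: Var_power lookup_single when_def)
  next
    case (add f g)
    then show ?case using keys_add[of f g] by blast
  next
    case (mult f g)
    show ?case
    proof (intro ballI allI)
      fix m i assume "m \<in> Poly_Mapping.keys (f * g)"
      then obtain a b where "m = a + b" "a \<in> Poly_Mapping.keys f" "b \<in> Poly_Mapping.keys g"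
        using keys_mult[of f g] by blast
      then show "p dvd Poly_Mapping.lookup m i" using mult.IH by (simp add: lookup_add)
    qed
  qed
next
  assume *: "\<forall>m\<in>Poly_Mapping.keys f. \<forall>i. p dvd Poly_Mapping.lookup m i"
  have "Poly_Mapping.single m c \<in> (pow_subalg p :: ('n, 'k) mpoly set)"
    if m: "\<forall>i. p dvd Poly_Mapping.lookup m i" for m and c :: 'k
  proof -
    have "Var i ^ Poly_Mapping.lookup m i \<in> (pow_subalg p :: ('n, 'k) mpoly set)" for i
    proof -
      obtain k where k: "Poly_Mapping.lookup m i = p * k" using m unfolding dvd_def by blast
      have "Var i ^ p \<in> (pow_subalg p :: ('n, 'k) mpoly set)" by (rule generated_subalgebra.gen) simp
      then show ?thesis unfolding k power_mult by (rule generated_subalgebra_power)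
    qed
    then show ?thesis
      unfolding single_eq_prod_Var
      by (intro generated_subalgebra.mult generated_subalgebra.const generated_subalgebra_prod)
  qed
  then have "(\<Sum>m\<in>Poly_Mapping.keys f. Poly_Mapping.single m (Poly_Mapping.lookup f m)) \<in> pow_subalg p"
    using * by (intro generated_subalgebra_sum) blast
  then show "f \<in> pow_subalg p" by (simp only: mpoly_eq_sum_single[symmetric])
qed

text \<open>Write \<open>c = c0 + c1\<close> with \<open>c0\<close> in the subring and no monomial
  of \<open>c1\<close> in it. Exponents of \<open>b\<close> vanish modulo \<open>p\<close>, so no
  monomial of \<open>b * c1\<close> lies in the subring either; yet
  \<open>b * c1 = b * c - b * c0\<close> does. Hence \<open>b * c1 = 0\<close> and
  \<open>c = c0\<close>.\<close>

lemma pow_subalg_saturated: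
  fixes b c :: "('n::{finite, linorder}, 'k::idom) mpoly"
  assumes b: "b \<in> pow_subalg p" "b \<noteq> 0" and bc: "b * c \<in> pow_subalg p"
  shows "c \<in> pow_subalg p"
proof -
  define G where "G = {m. \<forall>i. p dvd Poly_Mapping.lookup (m :: 'n \<Rightarrow>\<^sub>0 nat) i}"
  define c0 where "c0 = (\<Sum>m\<in>Poly_Mapping.keys c \<inter> G. Poly_Mapping.single m (Poly_Mapping.lookup c m))"
  define c1 where "c1 = (\<Sum>m\<in>Poly_Mapping.keys c - G. Poly_Mapping.single m (Poly_Mapping.lookup c m))"
  have "c = c0 + c1"
    using mpoly_eq_sum_single[of c] sum.Int_Diff[of "Poly_Mapping.keys c" _ G]
    unfolding c0_def c1_def by (metis finite_keys)
  have c0: "c0 \<in> pow_subalg p"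
    unfolding c0_def by (intro generated_subalgebra_sum) (auto simp: pow_subalg_iff G_def)
  have c1: "Poly_Mapping.keys c1 \<inter> G = {}"
    using keys_sum[of "\<lambda>m. Poly_Mapping.single m (Poly_Mapping.lookup c m)" "Poly_Mapping.keys c - G"]
    by (auto simp: c1_def in_keys_iff lookup_sum lookup_single when_def)
  have "b * c1 = b * c - b * c0" using \<open>c = c0 + c1\<close> by (simp add: distrib_left)
  then have "b * c1 \<in> pow_subalg p"
    using is_subring_diff[OF is_subring_generated_subalgebra bc generated_subalgebra.mult[OF b(1) c0]]
    by simp
  then have sub: "Poly_Mapping.keys (b * c1) \<subseteq> G" by (auto simp: pow_subalg_iff G_def)
  have "Poly_Mapping.keys (b * c1) \<inter> G = {}"
  proof (intro equals0I, elim IntE)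
    fix m assume m: "m \<in> Poly_Mapping.keys (b * c1)" "m \<in> G"
    then obtain a k where ak: "m = a + k" "a \<in> Poly_Mapping.keys b" "k \<in> Poly_Mapping.keys c1"
      using keys_mult[of b c1] by blast
    have "a \<in> G" using b(1) ak(2) by (simp add: pow_subalg_iff G_def)
    then have "k \<in> G" using m(2) ak(1) unfolding G_def
      by (simp add: lookup_add) (metis dvd_add_right_iff)
    then show False using c1 ak(3) by blast
  qed
  then have "Poly_Mapping.keys (b * c1) = {}" using sub by blast
  then have "b * c1 = 0"
    by (intro poly_mapping_eqI) (metis empty_iff in_keys_iff lookup_zero)
  then show ?thesis using b(2) c0 \<open>c = c0 + c1\<close> by simp
qed

text \<open>The case \<open>p = 1\<close> of the description by exponents.\<close>

lemma generated_subalgebra_Var: "f \<in> generated_subalgebra (range (Var :: 'n::finite \<Rightarrow> _))"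
  using pow_subalg_iff[of f 1] by simp

section \<open>Derivations determined by their values on the variables\<close>

lemma K_derivation_eqI:
  fixes D E :: "('n::finite, 'k::comm_ring_1) mpoly \<Rightarrow> ('n, 'k) mpoly"
  assumes D: "K_derivation D" and E: "K_derivation E" and eq: "\<And>j. D (Var j) = E (Var j)"
  shows "D f = E f"
  using generated_subalgebra_Var[of f]
  by induction
     (auto simp: K_derivation_Const[OF D] K_derivation_Const[OF E] eq K_derivation_add[OF D]
      K_derivation_add[OF E] K_derivation_mult[OF D] K_derivation_mult[OF E])

lemma K_derivation_comb:
  assumes "\<And>l. l \<in> A \<Longrightarrow> K_derivation (D l)"
  shows "K_derivation (\<lambda>g. \<Sum>l\<in>A. D l g * v l)"
  unfolding K_derivation_def
proof (intro conjI allI)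
  show "(\<Sum>l\<in>A. D l (f + g) * v l) = (\<Sum>l\<in>A. D l f * v l) + (\<Sum>l\<in>A. D l g * v l)" for f g
    unfolding sum.distrib[symmetric]
    by (intro sum.cong) (simp_all add: K_derivation_add[OF assms] distrib_right)
  show "(\<Sum>l\<in>A. D l (Const c * f) * v l) = Const c * (\<Sum>l\<in>A. D l f * v l)" for c f
    unfolding sum_distrib_left
    by (intro sum.cong) (simp_all add: K_derivation_scale[OF assms] mult.assoc)
  show "(\<Sum>l\<in>A. D l (f * g) * v l) =
      (\<Sum>l\<in>A. D l f * v l) * g + f * (\<Sum>l\<in>A. D l g * v l)" for f g
    unfolding sum_distrib_left sum_distrib_right sum.distrib[symmetric]
    by (intro sum.cong) (simp_all add: K_derivation_mult[OF assms] algebra_simps)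
qed

text \<open>Both sides are derivations and they agree on the variables.\<close>

lemma K_derivation_eq_sum:
  fixes d :: "('n::finite, 'k::comm_ring_1) mpoly \<Rightarrow> ('n, 'k) mpoly"
  assumes "K_derivation d"
  shows "d f = (\<Sum>l\<in>UNIV. partial_deriv l f * d (Var l))"
proof -
  have "K_derivation (\<lambda>f. \<Sum>l\<in>UNIV. partial_deriv l f * d (Var l))"
    by (intro K_derivation_comb K_derivation_partial_deriv)
  then show ?thesis
    by (rule K_derivation_eqI[OF assms]) (simp add: partial_deriv_Var if_distrib[of "\<lambda>x. x * _"] cong: if_cong)
qed

text \<open>With the product rule, this makes every K-derivation linear over the subring.\<close>

lemma K_derivation_pow_subalg:
  fixes d :: "('n::finite, 'k::comm_ring_1) mpoly \<Rightarrow> ('n, 'k) mpoly"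
  assumes d: "K_derivation d" and p: "CHAR('k) = p" and "b \<in> pow_subalg p"
  shows "d b = 0"
  using assms(3)
proof induction
  case (gen s)
  then show ?case using K_derivation_power_CHAR[OF d p] by auto
qed (simp_all add: K_derivation_Const[OF d] K_derivation_add[OF d] K_derivation_mult[OF d])

section \<open>Linear dependence over a subring and the rank bound\<close>

lemma linear_dependent_over_subring:
  fixes v :: "'j \<Rightarrow> 'i \<Rightarrow> 'a::idom"
  assumes R: "is_subring R" and "finite I" "finite J" "card I < card J"
    and "\<And>j i. j \<in> J \<Longrightarrow> i \<in> I \<Longrightarrow> v j i \<in> R"
  shows "\<exists>c. (\<forall>j\<in>J. c j \<in> R) \<and> (\<exists>j\<in>J. c j \<noteq> 0) \<and> (\<forall>i\<in>I. (\<Sum>j\<in>J. c j * v j i) = 0)"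
  using assms(2-)
proof (induction I arbitrary: J v)
  case empty
  then have "J \<noteq> {}" by auto
  then show ?case using is_subring_1[OF R] by (intro exI[of _ "\<lambda>_. 1"]) auto
next
  case (insert i0 I)
  show ?case
  proof (cases "\<forall>j\<in>J. v j i0 = 0")
    case True
    obtain c where c: "\<forall>j\<in>J. c j \<in> R" "\<exists>j\<in>J. c j \<noteq> 0" "\<forall>i\<in>I. (\<Sum>j\<in>J. c j * v j i) = 0"
      using insert.IH[of J v] insert.prems insert.hyps by auto
    then show ?thesis using True by (intro exI[of _ c]) auto
  next
    case False
    then obtain k where k: "k \<in> J" "v k i0 \<noteq> 0" by blast
    \<comment> \<open>Elimination of the coordinate \<open>i0\<close> with pivot row
      \<open>k\<close>. Cross-multiplication replaces division, so the entries remain in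
      \<open>R\<close>.\<close>
    define w where "w j i = v k i0 * v j i - v j i0 * v k i" for j i
    have wR: "w j i \<in> R" if "j \<in> J - {k}" "i \<in> I" for j i
      unfolding w_def using insert.prems(3) k(1) that
      by (intro is_subring_diff[OF R] is_subring_mult[OF R]) auto
    have "card I < card (J - {k})" using insert.prems insert.hyps k(1) by simp
    from insert.IH[of "J - {k}" w, OF _ this wR] obtain c where
      c: "\<forall>j\<in>J - {k}. c j \<in> R" "\<exists>j\<in>J - {k}. c j \<noteq> 0" "\<forall>i\<in>I. (\<Sum>j\<in>J - {k}. c j * w j i) = 0"
      using insert.prems(1) by auto
    \<comment> \<open>Undoes the elimination: the coefficient at the pivot collects the multiples of
      row \<open>k\<close> that were subtracted.\<close>
    define c' where "c' j = (if j = k then - (\<Sum>l\<in>J - {k}. c l * v l i0) else c j * v k i0)" for j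
    have "- (\<Sum>l\<in>J - {k}. c l * v l i0) \<in> R"
    proof -
      have "(\<Sum>l\<in>J - {k}. c l * v l i0) \<in> R"
        using c(1) insert.prems(3) by (intro is_subring_sum[OF R] is_subring_mult[OF R]) auto
      then show ?thesis using is_subring_diff[OF R is_subring_0[OF R]] by fastforce
    qed
    then have "\<forall>j\<in>J. c' j \<in> R"
      using c(1) insert.prems(3) k(1) by (auto simp: c'_def intro!: is_subring_mult[OF R])
    moreover have "\<exists>j\<in>J. c' j \<noteq> 0" using c(2) k(2) by (auto simp: c'_def)
    moreover have "(\<Sum>j\<in>J. c' j * v j i) = 0" if i: "i \<in> insert i0 I" for i
    proof -
      have "(\<Sum>j\<in>J. c' j * v j i) = c' k * v k i + (\<Sum>j\<in>J - {k}. c' j * v j i)"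
        using insert.prems(1) k(1) by (rule sum.remove)
      also have "(\<Sum>j\<in>J - {k}. c' j * v j i) = (\<Sum>j\<in>J - {k}. c j * v k i0 * v j i)"
        by (intro sum.cong) (auto simp: c'_def)
      also have "c' k * v k i = - (\<Sum>j\<in>J - {k}. c j * v j i0 * v k i)"
        by (simp add: c'_def sum_distrib_right)
      also have "\<dots> + (\<Sum>j\<in>J - {k}. c j * v k i0 * v j i) = (\<Sum>j\<in>J - {k}. c j * w j i)"
        by (simp add: w_def algebra_simps sum_subtractf)
      also have "\<dots> = 0" using c(3) i by (auto simp: w_def)
      finally show ?thesis .
    qed
    ultimately show ?thesis by blast
  qed
qed

text \<open>Division of every exponent by \<open>p\<close> with remainder: the quotients go into the
  coefficient, the remainders into the monomial.\<close>

lemma mpoly_span_pow_subalg: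
  fixes f :: "('n::finite, 'k::comm_ring_1) mpoly"
  assumes p: "p > 0"
  shows "\<exists>b. (\<forall>e. b e \<in> pow_subalg p) \<and>
    f = (\<Sum>e\<in>UNIV \<rightarrow>\<^sub>E {..<p}. b e * (\<Prod>i\<in>UNIV. Var i ^ e i))"
proof -
  let ?E = "(UNIV :: 'n set) \<rightarrow>\<^sub>E {..<p}"
  have fin: "finite ?E" by (intro finite_PiE) auto
  have 1: "\<exists>b. (\<forall>e. b e \<in> pow_subalg p) \<and>
      Poly_Mapping.single m c = (\<Sum>e\<in>?E. b e * (\<Prod>i\<in>UNIV. Var i ^ e i))" for m and c :: 'k
  proof -
    define e0 where "e0 = (\<lambda>i. Poly_Mapping.lookup m i mod p)"
    define a where "a = Const c * (\<Prod>i\<in>UNIV. (Var i ^ p) ^ (Poly_Mapping.lookup m i div p))"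
    have e0: "e0 \<in> ?E" using p by (auto simp: e0_def)
    have a: "a \<in> pow_subalg p" unfolding a_def
      by (intro generated_subalgebra.mult generated_subalgebra.const generated_subalgebra_prod
          generated_subalgebra_power generated_subalgebra.gen) simp
    have "Poly_Mapping.single m c = a * (\<Prod>i\<in>UNIV. Var i ^ e0 i)"
      unfolding a_def e0_def single_eq_prod_Var
      by (simp add: mult.assoc prod.distrib[symmetric] power_mult[symmetric] power_add[symmetric])
    also have "\<dots> = (\<Sum>e\<in>?E. (if e = e0 then a else 0) * (\<Prod>i\<in>UNIV. Var i ^ e i))"
      using fin e0 by (simp add: if_distrib[of "\<lambda>x. x * _"] cong: if_cong)
    finally show ?thesis
      using a generated_subalgebra.const[of 0] by (intro exI[of _ "\<lambda>e. if e = e0 then a else 0"]) auto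
  qed
  have "\<forall>m. \<exists>b. (\<forall>e. b e \<in> pow_subalg p) \<and>
      Poly_Mapping.single m (Poly_Mapping.lookup f m) = (\<Sum>e\<in>?E. b e * (\<Prod>i\<in>UNIV. Var i ^ e i))"
    by (intro allI 1)
  from choice[OF this] obtain b where "\<forall>m. (\<forall>e. b m e \<in> pow_subalg p) \<and>
      Poly_Mapping.single m (Poly_Mapping.lookup f m) = (\<Sum>e\<in>?E. b m e * (\<Prod>i\<in>UNIV. Var i ^ e i))" ..
  then have b: "b m e \<in> pow_subalg p"
    "Poly_Mapping.single m (Poly_Mapping.lookup f m) = (\<Sum>e\<in>?E. b m e * (\<Prod>i\<in>UNIV. Var i ^ e i))" for m e
    by blast+
  have "f = (\<Sum>m\<in>Poly_Mapping.keys f. Poly_Mapping.single m (Poly_Mapping.lookup f m))"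
    by (rule mpoly_eq_sum_single)
  also have "\<dots> = (\<Sum>e\<in>?E. (\<Sum>m\<in>Poly_Mapping.keys f. b m e) * (\<Prod>i\<in>UNIV. Var i ^ e i))"
    unfolding sum_distrib_right by (subst sum.swap) (simp only: b(2)[symmetric])
  finally show ?thesis using b(1)
    by (intro exI[of _ "\<lambda>e. \<Sum>m\<in>Poly_Mapping.keys f. b m e"])
       (auto intro: generated_subalgebra_sum)
qed

text \<open>The \<open>p ^ CARD('n)\<close> monomials with exponents below \<open>p\<close> span the
  polynomial ring over the subring, so more elements than that are dependent.\<close>

lemma mpoly_linear_dependent:
  fixes u :: "'j \<Rightarrow> ('n::{finite, linorder}, 'k::idom) mpoly"
  assumes p: "p > 0" and J: "finite J" "card J > p ^ CARD('n)"
  shows "\<exists>c. (\<forall>j\<in>J. c j \<in> pow_subalg p) \<and> (\<exists>j\<in>J. c j \<noteq> 0) \<and> (\<Sum>j\<in>J. c j * u j) = 0"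
proof -
  let ?E = "(UNIV :: 'n set) \<rightarrow>\<^sub>E {..<p}"
  have E: "finite ?E" "card ?E < card J" using J by (auto intro!: finite_PiE simp: card_PiE)
  have "\<forall>j. \<exists>b. (\<forall>e. b e \<in> pow_subalg p) \<and> u j = (\<Sum>e\<in>?E. b e * (\<Prod>i\<in>UNIV. Var i ^ e i))"
    by (intro allI mpoly_span_pow_subalg[OF p])
  from choice[OF this] obtain b where
    "\<forall>j. (\<forall>e. b j e \<in> pow_subalg p) \<and> u j = (\<Sum>e\<in>?E. b j e * (\<Prod>i\<in>UNIV. Var i ^ e i))" ..
  then have b: "b j e \<in> pow_subalg p" "u j = (\<Sum>e\<in>?E. b j e * (\<Prod>i\<in>UNIV. Var i ^ e i))" for j e
    by blast+
  from linear_dependent_over_subring[OF is_subring_generated_subalgebra E(1) J(1) E(2), of b] b(1)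
  obtain c where c: "\<forall>j\<in>J. c j \<in> pow_subalg p" "\<exists>j\<in>J. c j \<noteq> 0"
    "\<forall>e\<in>?E. (\<Sum>j\<in>J. c j * b j e) = 0" by blast
  have "(\<Sum>j\<in>J. c j * u j) = (\<Sum>j\<in>J. \<Sum>e\<in>?E. c j * b j e * (\<Prod>i\<in>UNIV. Var i ^ e i))"
    unfolding b(2) sum_distrib_left by (simp only: mult.assoc)
  also have "\<dots> = (\<Sum>e\<in>?E. (\<Sum>j\<in>J. c j * b j e) * (\<Prod>i\<in>UNIV. Var i ^ e i))"
    unfolding sum_distrib_right by (rule sum.swap)
  also have "\<dots> = 0" using c(3) by simp
  finally show ?thesis using c by blast
qed

section \<open>Jacobian determinants\<close>

lemma bij_nth_var: "bij_betw (nth_var :: nat \<Rightarrow> 'n::{finite, linorder}) {..<CARD('n)} UNIV"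
  unfolding nth_var_def by (rule bij_betw_nth) auto

lemma ex_nth_var:
  obtains k where "k < CARD('n)" "(j :: 'n::{finite, linorder}) = nth_var k"
  using bij_nth_var[where ?'n = 'n] unfolding bij_betw_def by (metis UNIV_I imageE lessThan_iff)

lemma sum_nth_var: "(\<Sum>l\<in>(UNIV :: 'n::{finite, linorder} set). g l) = (\<Sum>k<CARD('n). g (nth_var k))"
  by (rule sum.reindex_bij_betw[OF bij_nth_var, symmetric])

lemma nth_var_eq_iff:
  "k < CARD('n) \<Longrightarrow> l < CARD('n) \<Longrightarrow> nth_var k = (nth_var l :: 'n::{finite, linorder}) \<longleftrightarrow> k = l"
  using bij_nth_var[where ?'n = 'n] by (auto simp: bij_betw_def inj_on_def)

abbreviation jac_mat ::
    "nat \<Rightarrow> (nat \<Rightarrow> ('n, 'k::comm_ring_1) mpoly) \<Rightarrow> (nat \<Rightarrow> 'n) \<Rightarrow> ('n, 'k) mpoly mat" where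
  "jac_mat m f js \<equiv> Matrix.mat m m (\<lambda>(i, k). partial_deriv (js k) (f i))"

lemma jac_cong: "(\<And>i. i < m \<Longrightarrow> f i = g i) \<Longrightarrow> jac m f js = jac m g js"
  unfolding jac_def by (rule arg_cong[where f = det]) (auto intro!: eq_matI)

text \<open>Laplace expansion along row \<open>i\<close>; its cofactors do not depend on the entry
  replaced. Hence the determinant is a derivation in \<open>g\<close>.\<close>

lemma jac_update:
  assumes i: "i < m"
  shows "jac m (f(i := g)) js = (\<Sum>k<m. partial_deriv (js k) g * cofactor (jac_mat m f js) i k)"
proof -
  have "jac m (f(i := g)) js = (\<Sum>k<m. jac_mat m (f(i := g)) js $$ (i, k) * cofactor (jac_mat m (f(i := g)) js) i k)"
    unfolding jac_def by (rule laplace_expansion_row[OF _ i]) simp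
  also have "\<dots> = (\<Sum>k<m. partial_deriv (js k) g * cofactor (jac_mat m f js) i k)"
  proof (intro sum.cong refl)
    fix k assume k: "k \<in> {..<m}"
    have "mat_delete (jac_mat m (f(i := g)) js) i k = mat_delete (jac_mat m f js) i k"
      using i by (auto simp: mat_delete_def intro!: eq_matI)
    then show "jac_mat m (f(i := g)) js $$ (i, k) * cofactor (jac_mat m (f(i := g)) js) i k =
        partial_deriv (js k) g * cofactor (jac_mat m f js) i k"
      using i k by (simp add: cofactor_def)
  qed
  finally show ?thesis .
qed

lemma K_derivation_jac_update:
  fixes f :: "nat \<Rightarrow> ('n, 'k::comm_ring_1) mpoly"
  assumes i: "i < m"
  shows "K_derivation (\<lambda>g. jac m (f(i := g)) js)"
  unfolding jac_update[OF i] by (intro K_derivation_comb K_derivation_partial_deriv)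

lemma jac_update_other:
  assumes "i < m" "k < m" "k \<noteq> i"
  shows "jac m (f(i := f k)) js = 0"
  unfolding jac_def
  by (rule det_identical_rows[of _ m i k]) (use assms in \<open>auto intro!: eq_vecI\<close>)

text \<open>The gradient of a variable is a unit vector, so the expansion leaves a single
  cofactor.\<close>

lemma jac_update_Var:
  fixes f :: "nat \<Rightarrow> ('n::{finite, linorder}, 'k::comm_ring_1) mpoly"
  assumes "i < CARD('n)" "k < CARD('n)"
  shows "jac CARD('n) (f(i := Var (nth_var k))) nth_var = cofactor (jac_mat CARD('n) f nth_var) i k"
proof -
  have "partial_deriv (nth_var l) (Var (nth_var k) :: ('n, 'k) mpoly) * c = (if l = k then c else 0)"
    if "l < CARD('n)" for l c
    using that assms by (simp add: partial_deriv_Var nth_var_eq_iff)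
  then show ?thesis
    unfolding jac_update[OF assms(1)] using assms(2) by simp
qed

text \<open>Cramer's rule: by the chain rule the Jacobian matrix maps the vector of the
  \<open>d (Var l)\<close> to that of the \<open>d (f i)\<close>. Multiplying by the adjugate
  isolates \<open>d (Var j)\<close>, and the adjugate entries are the determinants with a row
  replaced by \<open>Var j\<close>.\<close>

lemma jac_mult_derivation_Var:
  fixes d :: "('n::{finite, linorder}, 'k::comm_ring_1) mpoly \<Rightarrow> ('n, 'k) mpoly"
  assumes d: "K_derivation d"
  shows "jac CARD('n) f nth_var * d (Var j) =
    (\<Sum>i<CARD('n). jac CARD('n) (f(i := Var j)) nth_var * d (f i))"
proof -
  let ?n = "CARD('n)" and ?J = "jac_mat CARD('n) f nth_var"
  obtain k where k: "k < ?n" "j = nth_var k" using ex_nth_var .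
  have J: "?J \<in> carrier_mat ?n ?n" by simp
  have adj: "(\<Sum>i<?n. cofactor ?J i k * partial_deriv (nth_var l) (f i)) = (if l = k then det ?J else 0)"
    if l: "l < ?n" for l
  proof -
    have "(adj_mat ?J * ?J) $$ (k, l) = (\<Sum>i\<in>{0..<?n}. cofactor ?J i k * partial_deriv (nth_var l) (f i))"
      using k l by (simp add: adj_mat_def scalar_prod_def)
    then show ?thesis
      unfolding adj_mat(3)[OF J] using k l by (cases "l = k") (simp_all add: lessThan_atLeast0)
  qed
  have "(\<Sum>i<?n. jac ?n (f(i := Var j)) nth_var * d (f i)) = (\<Sum>i<?n. cofactor ?J i k * d (f i))"
    using k by (intro sum.cong) (simp_all add: jac_update_Var)
  also have "\<dots> = (\<Sum>i<?n. \<Sum>l<?n. cofactor ?J i k * partial_deriv (nth_var l) (f i) * d (Var (nth_var l)))"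
    unfolding K_derivation_eq_sum[OF d, of "f _"] sum_nth_var by (simp only: sum_distrib_left mult.assoc)
  also have "\<dots> = (\<Sum>l<?n. (\<Sum>i<?n. cofactor ?J i k * partial_deriv (nth_var l) (f i)) * d (Var (nth_var l)))"
    unfolding sum_distrib_right by (rule sum.swap)
  also have "\<dots> = (\<Sum>l<?n. if l = k then det ?J * d (Var (nth_var l)) else 0)"
    by (intro sum.cong) (simp_all add: adj)
  also have "\<dots> = jac ?n f nth_var * d (Var j)" using k by (simp add: jac_def)
  finally show ?thesis by simp
qed

lemma jacobian_derivation_of_eq:
  "jacobian_derivation_of f g = jac CARD('n) (f(CARD('n) - 1 := g)) (nth_var :: nat \<Rightarrow> 'n::{finite, linorder})"
  unfolding jacobian_derivation_of_def by (rule jac_cong) auto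

lemma K_derivation_jacobian_derivation_of: "K_derivation (jacobian_derivation_of f)"
  unfolding jacobian_derivation_of_eq by (rule K_derivation_jac_update) simp

lemma jacobian_derivation_of_const:
  assumes "i < CARD('n) - 1"
  shows "jacobian_derivation_of f (f i :: ('n::{finite, linorder}, 'k::comm_ring_1) mpoly) = 0"
  unfolding jacobian_derivation_of_eq
  using jac_update_other[of "CARD('n) - 1" "CARD('n)" i f nth_var] assms by simp

text \<open>In Cramer's rule for the family \<open>f\<close> completed by \<open>g\<close>, only the
  summand of the last row survives.\<close>

lemma derivation_proportional:
  fixes d :: "('n::{finite, linorder}, 'k::comm_ring_1) mpoly \<Rightarrow> ('n, 'k) mpoly"
  assumes d: "K_derivation d" and f: "\<And>i. i < CARD('n) - 1 \<Longrightarrow> d (f i) = 0"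
  shows "jacobian_derivation_of f g * d (Var j) = d g * jacobian_derivation_of f (Var j)"
proof -
  let ?n = "CARD('n)" and ?f = "f(CARD('n) - 1 := g)"
  have "jac ?n ?f nth_var * d (Var j) = (\<Sum>i<?n. jac ?n (?f(i := Var j)) nth_var * d (?f i))"
    by (rule jac_mult_derivation_Var[OF d])
  also have "\<dots> = (\<Sum>i<?n. if i = ?n - 1 then jac ?n (f(?n - 1 := Var j)) nth_var * d g else 0)"
    using f by (intro sum.cong) auto
  also have "\<dots> = jac ?n (f(?n - 1 := Var j)) nth_var * d g" by simp
  finally show ?thesis by (simp add: jacobian_derivation_of_eq mult.commute)
qed

text \<open>Up to sign, the value at a variable is the maximal minor that omits the column of this
  variable.\<close>

lemma jacobian_derivation_of_Var_dvd:
  fixes f :: "nat \<Rightarrow> ('n::{finite, linorder}, 'k::comm_ring_1) mpoly"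
  assumes h: "\<And>js. h dvd jac (CARD('n) - 1) f js"
  shows "h dvd jacobian_derivation_of f (Var j)"
proof -
  let ?n = "CARD('n)"
  obtain k where k: "k < ?n" "j = nth_var k" using ex_nth_var .
  have "mat_delete (jac_mat ?n f nth_var) (?n - 1) k =
      jac_mat (?n - 1) f (\<lambda>i. nth_var (if i < k then i else Suc i))"
    using k by (intro eq_matI) (auto simp: mat_delete_def)
  then have "cofactor (jac_mat ?n f nth_var) (?n - 1) k =
      (- 1) ^ (?n - 1 + k) * jac (?n - 1) f (\<lambda>i. nth_var (if i < k then i else Suc i))"
    by (simp add: cofactor_def jac_def)
  then show ?thesis
    unfolding jacobian_derivation_of_eq k(2) using h k(1) by (simp add: jac_update_Var)
qed

text \<open>A minor omitting a row and a column is, up to the determinant of the matrix selecting its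
  columns, the full Jacobian determinant with the omitted row filled by a variable outside \<open>js\<close>.\<close>

lemma dvd_jac_minor:
  fixes f :: "nat \<Rightarrow> ('n::{finite, linorder}, 'k::comm_ring_1) mpoly"
  assumes h: "\<And>j. h dvd jacobian_derivation_of f (Var j)"
  shows "h dvd jac (CARD('n) - 1) f js"
proof -
  let ?n = "CARD('n)"
  define m where "m = ?n - 1"
  have n: "?n = Suc m" by (simp add: m_def)
  \<comment> \<open>The columns \<open>js\<close> number one less than the variables, so even with
    repetitions some variable \<open>x\<close> is missed.\<close>
  have "card (js ` {..<m}) \<le> m" using card_image_le[of "{..<m}" js] by simp
  then have "js ` {..<m} \<noteq> UNIV" using n by auto
  then obtain x where x: "x \<notin> js ` {..<m}" by blast
  define F where "F = f(m := Var x)"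
  define js' where "js' = js(m := x)"
  \<comment> \<open>The matrix selecting the columns \<open>js'\<close>. For repeated columns its
    determinant vanishes, so no separate case arises.\<close>
  define P :: "('n, 'k) mpoly mat" where
    "P = Matrix.mat ?n ?n (\<lambda>(l, k). if nth_var l = js' k then 1 else 0)"
  have prod: "jac_mat ?n F js' = jac_mat ?n F nth_var * P"
  proof (rule eq_matI)
    fix i k assume "i < dim_row (jac_mat ?n F nth_var * P)" "k < dim_col (jac_mat ?n F nth_var * P)"
    then have ik: "i < ?n" "k < ?n" by (simp_all add: P_def)
    have "(jac_mat ?n F nth_var * P) $$ (i, k) =
        (\<Sum>l\<in>{0..<?n}. partial_deriv (nth_var l) (F i) * (if nth_var l = js' k then 1 else 0))"
      using ik by (simp add: P_def scalar_prod_def)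
    also have "\<dots> = (\<Sum>l\<in>UNIV. partial_deriv l (F i) * (if l = js' k then 1 else 0))"
      by (simp only: sum_nth_var lessThan_atLeast0)
    also have "\<dots> = partial_deriv (js' k) (F i)"
      by (simp add: if_distrib[of "\<lambda>x. _ * x"] cong: if_cong)
    finally show "jac_mat ?n F js' $$ (i, k) = (jac_mat ?n F nth_var * P) $$ (i, k)"
      using ik by simp
  qed (simp_all add: P_def)
  have "jac ?n F js' = jac ?n F nth_var * det P"
    unfolding jac_def prod by (rule det_mult[of _ "?n"]) (simp_all add: P_def)
  also have "jac ?n F nth_var = jacobian_derivation_of f (Var x)"
    unfolding jacobian_derivation_of_eq F_def m_def ..
  finally have "h dvd jac ?n F js'" using h by simp
  moreover have "jac ?n F js' = jac m f js"
  proof -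
    have "mat_delete (jac_mat ?n f js') m m = jac_mat m f js"
      by (intro eq_matI) (auto simp: mat_delete_def n js'_def)
    then have cof: "cofactor (jac_mat ?n f js') m m = jac m f js"
      by (simp add: cofactor_def jac_def)
    have "jac ?n F js' = (\<Sum>k<?n. partial_deriv (js' k) (Var x) * cofactor (jac_mat ?n f js') m k)"
      unfolding F_def by (rule jac_update) (simp add: n)
    also have "\<dots> = (\<Sum>k<?n. if k = m then cofactor (jac_mat ?n f js') m k else 0)"
      using x by (intro sum.cong) (auto simp: partial_deriv_Var js'_def n)
    also have "\<dots> = jac m f js" using cof by (simp add: n)
    finally show ?thesis .
  qed
  ultimately show ?thesis by (simp add: m_def)
qed

section \<open>Divisibility of coefficients by means of derivations\<close>

lemma of_nat_mpoly_unit: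
  assumes p: "CHAR('k::idom) = p" "p > 0" and i: "0 < i" "i < p"
  shows "\<exists>l. of_nat l * of_nat i = (1 :: ('n::linorder, 'k) mpoly)"
proof -
  have "prime p" using prime_CHAR_semidom[where ?'a = 'k] p by simp
  then have "coprime i p" using i
    by (metis coprime_commute nat_dvd_not_less prime_imp_coprime_nat)
  \<comment> \<open>An inverse of \<open>i\<close> modulo the prime \<open>p\<close> is an inverse
    in characteristic \<open>p\<close>.\<close>
  then obtain x where "[i * x = Suc 0] (mod p)" using cong_solve_coprime_nat by blast
  then have "i * x mod p = 1" using i by (simp add: cong_def)
  then have "i * x = p * (i * x div p) + 1" by (metis mult_div_mod_eq)
  then have "of_nat (i * x) = (of_nat (p * (i * x div p) + 1) :: ('n, 'k) mpoly)" by (rule arg_cong)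
  also have "\<dots> = 1"
    using of_nat_CHAR[where ?'a = 'k] p by (simp add: of_nat_mpoly)
  finally show ?thesis by (intro exI[of _ x]) (simp add: mult.commute)
qed

lemma dvd_of_nat_mult_cancel:
  fixes b c :: "('n::linorder, 'k::idom) mpoly"
  assumes "CHAR('k) = p" "p > 0" "0 < i" "i < p" and dvd: "b dvd of_nat i * c"
  shows "b dvd c"
proof -
  obtain l where "of_nat l * of_nat i = (1 :: ('n, 'k) mpoly)" using of_nat_mpoly_unit[OF assms(1-4)] by blast
  then have "c = of_nat l * (of_nat i * c)" by (simp add: mult.assoc[symmetric])
  then show ?thesis using dvd by (metis dvd_mult)
qed

text \<open>With \<open>b = 0\<close> the following two lemmas assert linear independence.\<close>

lemma dvd_coeffs_of_dvd_power_sum: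
  fixes E :: "'j \<Rightarrow> ('n::linorder, 'k::idom) mpoly \<Rightarrow> ('n, 'k) mpoly"
  assumes E: "\<And>j. j \<in> S \<Longrightarrow> K_derivation (E j)" and p: "CHAR('k) = p" "p > 0"
    and b: "\<And>j. j \<in> S \<Longrightarrow> E j b = 0"
    and cop: "\<And>h. (\<And>j. j \<in> S \<Longrightarrow> b dvd E j y * h) \<Longrightarrow> b dvd h"
    and "m \<le> p" "\<And>i j. i < m \<Longrightarrow> j \<in> S \<Longrightarrow> E j (c i) = 0" "b dvd (\<Sum>i<m. c i * y ^ i)" "i < m"
  shows "b dvd c i"
  using assms(6-)
proof (induction m arbitrary: c i)
  case (Suc m)
  \<comment> \<open>Applying \<open>E j\<close> keeps divisibility by \<open>b\<close>, because
    \<open>E j b = 0\<close>, and differentiates the sum in \<open>y\<close>. The common factor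
    \<open>E j y\<close> is then removed by \<open>cop\<close>.\<close>
  have "b dvd (\<Sum>i<m. of_nat (Suc i) * c (Suc i) * y ^ i)"
  proof (rule cop)
    fix j assume j: "j \<in> S"
    note d = E[OF j]
    obtain q where "(\<Sum>i<Suc m. c i * y ^ i) = b * q" using Suc.prems(3) by blast
    then have "E j (\<Sum>i<Suc m. c i * y ^ i) = E j (b * q)" by (rule arg_cong)
    also have "\<dots> = b * E j q" by (simp add: K_derivation_mult[OF d] b[OF j])
    finally have "b dvd E j (\<Sum>i<Suc m. c i * y ^ i)" by simp
    also have "E j (\<Sum>i<Suc m. c i * y ^ i) = (\<Sum>i<Suc m. c i * (of_nat i * y ^ (i - 1) * E j y))"
      unfolding K_derivation_sum[OF d]
      by (intro sum.cong) (auto simp: K_derivation_mult[OF d] K_derivation_power[OF d] Suc.prems(2) j)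
    also have "\<dots> = E j y * (\<Sum>i<m. of_nat (Suc i) * c (Suc i) * y ^ i)"
      by (subst sum.lessThan_Suc_shift) (simp add: sum_distrib_left mult_ac)
    finally show "b dvd E j y * (\<Sum>i<m. of_nat (Suc i) * c (Suc i) * y ^ i)" .
  qed
  moreover have "E j (of_nat (Suc i) * c (Suc i)) = 0" if "i < m" "j \<in> S" for i j
    using that Suc.prems(2)[of "Suc i" j] unfolding of_nat_mpoly
    by (simp only: K_derivation_scale[OF E[OF that(2)]]) simp
  ultimately have "b dvd of_nat (Suc i) * c (Suc i)" if "i < m" for i
    using Suc.IH[of "\<lambda>i. of_nat (Suc i) * c (Suc i)" i] Suc.prems(1) that by simp
  \<comment> \<open>The factor \<open>Suc i\<close> is below \<open>p\<close>, hence
    invertible.\<close>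
  then have *: "b dvd c (Suc i)" if "i < m" for i
    using dvd_of_nat_mult_cancel[OF p, of "Suc i" b "c (Suc i)"] Suc.prems(1) that by simp
  have "(\<Sum>i<Suc m. c i * y ^ i) = c 0 + (\<Sum>i<m. c (Suc i) * y ^ Suc i)"
    by (subst sum.lessThan_Suc_shift) simp
  moreover have "b dvd (\<Sum>i<m. c (Suc i) * y ^ Suc i)"
    by (intro dvd_sum dvd_mult2 *) simp
  ultimately have "b dvd c 0" using Suc.prems(3) by (simp add: dvd_add_left_iff)
  then show ?case using * Suc.prems(4) by (cases i) auto
qed simp

lemma sum_PiE_Suc:
  fixes g :: "(nat \<Rightarrow> 'a) \<Rightarrow> 'b::comm_monoid_add"
  assumes "finite A"
  shows "(\<Sum>e\<in>{..<Suc k} \<rightarrow>\<^sub>E A. g e) = (\<Sum>i\<in>A. \<Sum>e\<in>{..<k} \<rightarrow>\<^sub>E A. g (e(k := i)))"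
proof -
  have "{..<Suc k} = insert k {..<k}" by auto
  then have eq: "{..<Suc k} \<rightarrow>\<^sub>E A = (\<lambda>(i, e). e(k := i)) ` (A \<times> ({..<k} \<rightarrow>\<^sub>E A))"
    by (simp add: PiE_insert_eq)
  have inj: "inj_on (\<lambda>(i, e). e(k := i)) (A \<times> ({..<k} \<rightarrow>\<^sub>E A))"
    by (rule inj_combinator) simp
  show ?thesis
    unfolding eq sum.reindex[OF inj] by (simp add: sum.cartesian_product case_prod_unfold)
qed

lemma prod_power_upd:
  fixes F :: "nat \<Rightarrow> 'a::comm_monoid_mult"
  shows "(\<Prod>i<Suc k. F i ^ (e(k := a)) i) = (\<Prod>i<k. F i ^ e i) * F k ^ a"
  by simp

lemma dvd_coeffs_of_dvd_monomial_sum: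
  fixes E :: "nat \<Rightarrow> 'j \<Rightarrow> ('n::{finite, linorder}, 'k::idom) mpoly \<Rightarrow> ('n, 'k) mpoly"
  assumes E: "\<And>k j. k < m \<Longrightarrow> j \<in> S \<Longrightarrow> K_derivation (E k j)" and p: "CHAR('k) = p" "p > 0"
    and EF: "\<And>k j i. i < k \<Longrightarrow> k < m \<Longrightarrow> j \<in> S \<Longrightarrow> E k j (F i) = 0"
    and b: "b \<in> pow_subalg p"
    and cop: "\<And>k h. k < m \<Longrightarrow> (\<And>j. j \<in> S \<Longrightarrow> b dvd E k j (F k) * h) \<Longrightarrow> b dvd h"
    and c: "\<And>e. e \<in> {..<m} \<rightarrow>\<^sub>E {..<p} \<Longrightarrow> c e \<in> pow_subalg p"
    and dvd: "b dvd (\<Sum>e\<in>{..<m} \<rightarrow>\<^sub>E {..<p}. c e * (\<Prod>i<m. F i ^ e i))"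
    and e: "e \<in> {..<m} \<rightarrow>\<^sub>E {..<p}"
  shows "b dvd c e"
  using E EF cop c dvd e
proof (induction m arbitrary: c e)
  case (Suc m)
  let ?I = "{..<m} \<rightarrow>\<^sub>E {..<p}"
  \<comment> \<open>The sum is read as a polynomial in the last element \<open>F m\<close>, with
    coefficients \<open>C i\<close>. Each \<open>E m j\<close> kills these, since it kills the
    subring and every \<open>F i\<close> with \<open>i < m\<close>.\<close>
  define C where "C i = (\<Sum>e\<in>?I. c (e(m := i)) * (\<Prod>i<m. F i ^ e i))" for i
  have upd: "e(m := i) \<in> {..<Suc m} \<rightarrow>\<^sub>E {..<p}" if "e \<in> ?I" "i < p" for e i
    using that by (auto simp: PiE_iff extensional_def)
  have dvdC: "b dvd C i" if i: "i < p" for i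
  proof (rule dvd_coeffs_of_dvd_power_sum[of S "E m" p b "F m" p C])
    show "K_derivation (E m j)" "E m j b = 0" if "j \<in> S" for j
      using Suc.prems(1) K_derivation_pow_subalg[OF _ p(1) b] that by auto
    show "b dvd h" if "\<And>j. j \<in> S \<Longrightarrow> b dvd E m j (F m) * h" for h
      using Suc.prems(3)[of m h] that by simp
    show "E m j (C i) = 0" if "i < p" "j \<in> S" for i j
    proof -
      have d: "K_derivation (E m j)" using Suc.prems(1) that by simp
      show ?thesis
        unfolding C_def K_derivation_sum[OF d] K_derivation_mult[OF d]
      proof (intro sum.neutral ballI)
        fix e assume "e \<in> ?I"
        then have "E m j (c (e(m := i))) = 0"
          using Suc.prems(4) upd that by (intro K_derivation_pow_subalg[OF d p(1)]) blast
        moreover have "E m j (\<Prod>i<m. F i ^ e i) = 0"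
          using Suc.prems(2)[of _ m j] that
          by (intro K_derivation_prod_0[OF d] K_derivation_power_0[OF d]) simp
        ultimately show "E m j (c (e(m := i))) * (\<Prod>i<m. F i ^ e i) +
            c (e(m := i)) * E m j (\<Prod>i<m. F i ^ e i) = 0" by simp
      qed
    qed
    show "b dvd (\<Sum>i<p. C i * F m ^ i)"
      using Suc.prems(5) unfolding sum_PiE_Suc[OF finite_lessThan] prod_power_upd C_def
      by (simp only: sum_distrib_right mult.assoc)
  qed (use p i in simp_all)
  have em: "e m < p" using Suc.prems(6) by auto
  have e': "restrict e {..<m} \<in> ?I" using Suc.prems(6) by (auto simp: PiE_iff)
  have "b dvd c ((restrict e {..<m})(m := e m))"
  proof (rule Suc.IH[of "\<lambda>e'. c (e'(m := e m))" "restrict e {..<m}"])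
    show "b dvd (\<Sum>e'\<in>?I. c (e'(m := e m)) * (\<Prod>i<m. F i ^ e' i))"
      using dvdC[OF em] by (simp only: C_def)
    show "b dvd h" if "k < m" "\<And>j. j \<in> S \<Longrightarrow> b dvd E k j (F k) * h" for k h
      using Suc.prems(3)[of k h] that by simp
    show "c (e'(m := e m)) \<in> pow_subalg p" if "e' \<in> ?I" for e'
      using Suc.prems(4) upd[OF that em] by blast
    show "restrict e {..<m} \<in> ?I" by (rule e')
    show "K_derivation (E k j)" if "k < m" "j \<in> S" for k j
      using Suc.prems(1) that by simp
    show "E k j (F i) = 0" if "i < k" "k < m" "j \<in> S" for k j i
      using Suc.prems(2) that by simp
  qed
  moreover have "(restrict e {..<m})(m := e m) = e"
    using Suc.prems(6) by (auto simp: fun_eq_iff PiE_iff extensional_def)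
  ultimately show ?case by simp
qed simp

section \<open>p-bases of rings of constants\<close>

lemma K_derivation_of_nat:
  fixes d :: "('n, 'k::comm_ring_1) mpoly \<Rightarrow> ('n, 'k) mpoly"
  shows "K_derivation d \<Longrightarrow> d (of_nat k) = 0"
  unfolding of_nat_mpoly by (rule K_derivation_Const)

lemma K_derivation_span_0:
  fixes d :: "('n::finite, 'k::comm_ring_1) mpoly \<Rightarrow> ('n, 'k) mpoly"
  assumes d: "K_derivation d" and p: "CHAR('k) = p"
    and f: "\<And>i. i < m \<Longrightarrow> d (f i) = 0" and c: "\<forall>e\<in>I. c e \<in> pow_subalg p"
  shows "d (\<Sum>e\<in>I. c e * (\<Prod>i<m. f i ^ e i)) = 0"
  unfolding K_derivation_sum[OF d]
proof (intro sum.neutral ballI)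
  fix e assume "e \<in> I"
  then have "d (c e) = 0" using c by (intro K_derivation_pow_subalg[OF d p]) blast
  moreover have "d (\<Prod>i<m. f i ^ e i) = 0"
    using f by (intro K_derivation_prod_0[OF d] K_derivation_power_0[OF d]) simp
  ultimately show "d (c e * (\<Prod>i<m. f i ^ e i)) = 0" by (simp add: K_derivation_mult[OF d])
qed

text \<open>The products of the monomials in \<open>f\<close> with the powers \<open>y ^ i\<close>,
  together with \<open>a\<close>, are one more than the rank bound and so dependent. The coefficient
  of \<open>a\<close> is nonzero: the powers of \<open>y\<close> are independent over the constants
  because \<open>d y\<close> is nonzero, and the monomials in \<open>f\<close> are independent by
  assumption.\<close>

lemma multiple_in_span:
  fixes d :: "('n::{finite, linorder}, 'k::idom) mpoly \<Rightarrow> ('n, 'k) mpoly"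
  assumes p: "CHAR('k) = p" "p > 0" and d: "K_derivation d"
    and f: "\<forall>i<CARD('n) - 1. d (f i) = 0"
    and indep: "\<forall>c. (\<forall>e\<in>{..<CARD('n) - 1} \<rightarrow>\<^sub>E {..<p}. c e \<in> pow_subalg p) \<and>
      (\<Sum>e\<in>{..<CARD('n) - 1} \<rightarrow>\<^sub>E {..<p}. c e * (\<Prod>i<CARD('n) - 1. f i ^ e i)) = 0 \<longrightarrow>
      (\<forall>e\<in>{..<CARD('n) - 1} \<rightarrow>\<^sub>E {..<p}. c e = 0)"
    and y: "d y \<noteq> 0"
  shows "\<exists>b c. b \<in> pow_subalg p \<and> b \<noteq> 0 \<and>
    (\<forall>i<p. \<forall>e\<in>{..<CARD('n) - 1} \<rightarrow>\<^sub>E {..<p}. c i e \<in> pow_subalg p) \<and>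
    b * a = (\<Sum>i<p. (\<Sum>e\<in>{..<CARD('n) - 1} \<rightarrow>\<^sub>E {..<p}. c i e * (\<Prod>i<CARD('n) - 1. f i ^ e i)) * y ^ i)"
proof -
  let ?m = "CARD('n) - 1"
  let ?I = "{..<?m} \<rightarrow>\<^sub>E {..<p}" and ?M = "\<lambda>e. \<Prod>i<?m. f i ^ e i"
  let ?K = "{..<p} \<times> ?I"
  \<comment> \<open>The index \<open>None\<close> stands for \<open>a\<close>; tagging indices keeps
    the count correct even if some of the elements coincide.\<close>
  define J where "J = insert None (Some ` ?K)"
  define u where "u x = (case x of None \<Rightarrow> a | Some (i, e) \<Rightarrow> ?M e * y ^ i)" for x
  have finK: "finite ?K" by (intro finite_cartesian_product finite_PiE) auto
  have finJ: "finite J" using finK by (simp add: J_def)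
  have "card ?K = p * p ^ ?m" by (simp add: card_cartesian_product card_PiE)
  also have "\<dots> = p ^ CARD('n)" by (simp flip: power_Suc)
  finally have "card J > p ^ CARD('n)" using finK by (simp add: J_def card_image)
  from mpoly_linear_dependent[OF p(2) finJ this, of u] obtain c where
    c: "\<forall>x\<in>J. c x \<in> pow_subalg p" "\<exists>x\<in>J. c x \<noteq> 0" "(\<Sum>x\<in>J. c x * u x) = 0" by blast
  have "(\<Sum>x\<in>J. c x * u x) = c None * a + (\<Sum>x\<in>?K. c (Some x) * u (Some x))"
    using finK by (simp add: J_def sum.reindex u_def)
  also have "(\<Sum>x\<in>?K. c (Some x) * u (Some x)) = (\<Sum>i<p. \<Sum>e\<in>?I. c (Some (i, e)) * u (Some (i, e)))"
    by (simp add: sum.cartesian_product)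
  also have "\<dots> = (\<Sum>i<p. (\<Sum>e\<in>?I. c (Some (i, e)) * ?M e) * y ^ i)"
    by (simp add: u_def sum_distrib_right mult.assoc)
  finally have eq: "c None * a + (\<Sum>i<p. (\<Sum>e\<in>?I. c (Some (i, e)) * ?M e) * y ^ i) = 0"
    using c(3) by simp
  have cB: "c (Some (i, e)) \<in> pow_subalg p" if "i < p" "e \<in> ?I" for i e
    using c(1) that by (simp add: J_def)
  have "c None \<noteq> 0"
  proof
    assume 0: "c None = 0"
    have "c (Some (i, e)) = 0" if i: "i < p" and e: "e \<in> ?I" for i e
    proof -
      \<comment> \<open>Divisibility by \<open>0\<close> expresses that the coefficient of
        \<open>y ^ i\<close> vanishes.\<close>
      have "0 dvd (\<Sum>e\<in>?I. c (Some (i, e)) * ?M e)"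
      proof (rule dvd_coeffs_of_dvd_power_sum[of "{()}" "\<lambda>_. d" p 0 y p "\<lambda>i. \<Sum>e\<in>?I. c (Some (i, e)) * ?M e"])
        show "d (\<Sum>e\<in>?I. c (Some (i, e)) * ?M e) = 0" if "i < p" for i
          by (rule K_derivation_span_0[OF d p(1) f[rule_format]]) (use cB[OF that] in blast)+
        show "0 dvd (\<Sum>i<p. (\<Sum>e\<in>?I. c (Some (i, e)) * ?M e) * y ^ i)" using eq 0 by simp
      qed (use d p y i in \<open>simp_all add: K_derivation_0\<close>)
      then have "(\<Sum>e\<in>?I. c (Some (i, e)) * ?M e) = 0" by (simp only: dvd_0_left_iff)
      then show ?thesis using indep[THEN spec, of "\<lambda>e. c (Some (i, e))"] cB[OF i] e by blast
    qed
    then show False using c(2) 0 by (auto simp: J_def)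
  qed
  have neg: "- c (Some (i, e)) \<in> pow_subalg p" if "i < p" "e \<in> ?I" for i e
    using is_subring_diff[OF is_subring_generated_subalgebra is_subring_0[OF is_subring_generated_subalgebra] cB[OF that]]
    by simp
  have "c None * a = (\<Sum>i<p. (\<Sum>e\<in>?I. - c (Some (i, e)) * ?M e) * y ^ i)"
    using eq by (simp add: sum_negf eq_neg_iff_add_eq_0)
  moreover have "c None \<in> pow_subalg p" using c(1) by (simp add: J_def)
  ultimately show ?thesis
    using \<open>c None \<noteq> 0\<close> neg by (intro exI[of _ "c None"] exI[of _ "\<lambda>i e. - c (Some (i, e))"]) blast
qed

text \<open>The localised slice theorem: over \<open>u\<inverse>\<close> the derivation \<open>u\<inverse> d\<close> has the slice \<open>y\<close>.
  The power of \<open>u\<close> clearing denominators is a multiple of \<open>p\<close>, hence a constant.\<close>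

lemma slice_expansion:
  fixes d :: "('n::{finite, linorder}, 'k::idom) mpoly \<Rightarrow> ('n, 'k) mpoly"
  assumes p: "CHAR('k) = p" "p > 0" and d: "K_derivation d"
    and b: "d b = 0" "b \<noteq> 0"
    and "m < p" "\<And>i. i \<le> m \<Longrightarrow> d (c i) = 0" "b * a = (\<Sum>i\<le>m. c i * y ^ i)"
  shows "\<exists>e. (\<forall>i\<le>m. d (e i) = 0) \<and> d y ^ (p * m) * a = (\<Sum>i\<le>m. e i * y ^ i)"
  using assms(6-)
proof (induction m arbitrary: a c)
  case 0
  have "b * d a = d (b * a)" by (simp add: K_derivation_mult[OF d] b)
  also have "\<dots> = 0" using 0 by simp
  finally have "d a = 0" using b by simp
  then show ?case by (intro exI[of _ "\<lambda>_. a"]) simp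
next
  case (Suc m)
  let ?u = "d y"
  \<comment> \<open>This is \<open>?u ^ p\<close> times the value at \<open>a\<close> of the
    localised derivation, which lowers the degree in \<open>y\<close> by one. The factor
    \<open>?u ^ p\<close> is a constant.\<close>
  define a1 where "a1 = ?u ^ (p - 1) * d a"
  have u: "?u ^ (p - 1) * ?u = ?u ^ p" using p(2) by (cases p) (simp_all add: mult.commute)
  have up: "d (?u ^ p) = 0" by (rule K_derivation_power_CHAR[OF d p(1)])
  have "b * d a = d (b * a)" by (simp add: K_derivation_mult[OF d] b)
  also have "\<dots> = (\<Sum>i\<le>Suc m. c i * (of_nat i * y ^ (i - 1) * ?u))"
    unfolding Suc.prems(3) K_derivation_sum[OF d]
    by (intro sum.cong) (auto simp: K_derivation_mult[OF d] K_derivation_power[OF d] Suc.prems(2))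
  also have "\<dots> = (\<Sum>i\<le>m. of_nat (Suc i) * c (Suc i) * y ^ i * ?u)"
    by (subst sum.atMost_Suc_shift) (simp add: mult_ac)
  finally have bd: "b * d a = (\<Sum>i\<le>m. of_nat (Suc i) * c (Suc i) * y ^ i * ?u)" .
  have "b * a1 = ?u ^ (p - 1) * (b * d a)" by (simp add: a1_def mult_ac)
  also have "\<dots> = (\<Sum>i\<le>m. (of_nat (Suc i) * c (Suc i) * ?u ^ p) * y ^ i)"
    unfolding bd sum_distrib_left u[symmetric] by (intro sum.cong) (simp_all add: mult_ac)
  finally have ba1: "b * a1 = (\<Sum>i\<le>m. (of_nat (Suc i) * c (Suc i) * ?u ^ p) * y ^ i)" .
  have "d (of_nat (Suc i) * c (Suc i) * ?u ^ p) = 0" if "i \<le> m" for i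
    using that Suc.prems(2)[of "Suc i"] up
    by (simp add: K_derivation_mult[OF d] K_derivation_of_nat[OF d] del: of_nat_Suc)
  from Suc.IH[OF _ this ba1] Suc.prems(1) obtain e where
    e: "\<forall>i\<le>m. d (e i) = 0" "?u ^ (p * m) * a1 = (\<Sum>i\<le>m. e i * y ^ i)" by auto
  have "\<forall>i. \<exists>l. i \<le> m \<longrightarrow> of_nat l * of_nat (Suc i) = (1 :: ('n, 'k) mpoly)"
  proof
    fix i
    show "\<exists>l. i \<le> m \<longrightarrow> of_nat l * of_nat (Suc i) = (1 :: ('n, 'k) mpoly)"
      using of_nat_mpoly_unit[OF p, where ?'n = 'n, of "Suc i"] Suc.prems(1) by (auto simp del: of_nat_Suc)
  qed
  from choice[OF this] obtain l where l: "\<And>i. i \<le> m \<Longrightarrow> of_nat (l i) * of_nat (Suc i) = (1 :: ('n, 'k) mpoly)"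
    by blast
  have dl: "d (of_nat (l i) * e i) = 0" if "i \<le> m" for i
    using that e(1) by (simp add: K_derivation_mult[OF d] K_derivation_of_nat[OF d])
  \<comment> \<open>Termwise antiderivative in \<open>y\<close> of the expansion from the induction
    hypothesis; \<open>l i\<close> inverts \<open>Suc i\<close>, which is below
    \<open>p\<close>.\<close>
  define s where "s = (\<Sum>i\<le>m. of_nat (l i) * e i * y ^ Suc i)"
  have "d s = (\<Sum>i\<le>m. ?u * (e i * y ^ i))"
    unfolding s_def K_derivation_sum[OF d]
  proof (intro sum.cong refl)
    fix i assume i: "i \<in> {..m}"
    have "d (of_nat (l i) * e i * y ^ Suc i) = of_nat (l i) * e i * (of_nat (Suc i) * y ^ i * ?u)"
      unfolding K_derivation_mult[OF d, of "of_nat (l i) * e i"] K_derivation_power[OF d]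
      using dl i by (simp del: of_nat_Suc)
    also have "\<dots> = (of_nat (l i) * of_nat (Suc i)) * (?u * (e i * y ^ i))" by (simp only: mult_ac)
    also have "of_nat (l i) * of_nat (Suc i) = (1 :: ('n, 'k) mpoly)" using l i by blast
    finally show "d (of_nat (l i) * e i * y ^ Suc i) = ?u * (e i * y ^ i)" by (simp only: mult_1)
  qed
  also have "\<dots> = ?u * (?u ^ (p * m) * a1)" by (simp add: e(2) sum_distrib_left)
  also have "\<dots> = (?u ^ (p - 1) * ?u) * ?u ^ (p * m) * d a" by (simp only: a1_def mult_ac)
  also have "\<dots> = ?u ^ (p * Suc m) * d a" unfolding u by (simp add: power_add)
  also have "\<dots> = d (?u ^ (p * Suc m) * a)"
  proof -
    have "d (?u ^ (p * Suc m)) = 0"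
      using K_derivation_power_0[OF d up, of "Suc m"] by (simp only: power_mult)
    then show ?thesis by (simp only: K_derivation_mult[OF d] mult_zero_left add_0)
  qed
  \<comment> \<open>The difference is a constant and becomes the coefficient of
    \<open>y ^ 0\<close>.\<close>
  finally have ds: "d (?u ^ (p * Suc m) * a - s) = 0" by (simp add: K_derivation_diff[OF d])
  define e' where "e' i = (case i of 0 \<Rightarrow> ?u ^ (p * Suc m) * a - s | Suc i \<Rightarrow> of_nat (l i) * e i)" for i
  have "\<forall>i\<le>Suc m. d (e' i) = 0" using ds dl by (auto simp: e'_def split: nat.split)
  moreover have "(\<Sum>i\<le>Suc m. e' i * y ^ i) = ?u ^ (p * Suc m) * a"
    unfolding sum.atMost_Suc_shift by (simp add: e'_def s_def)
  ultimately show ?case by (intro exI[of _ e']) simp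
qed

text \<open>Polynomials whose gradient is a combination of the gradients of the \<open>F i\<close>.
  Closure under sums and products gives the chain rule for all polynomial expressions in
  \<open>F\<close> over elements with zero gradient, without a substitution map.\<close>

definition chain_rule_set :: "nat \<Rightarrow> (nat \<Rightarrow> ('n, 'k::comm_ring_1) mpoly) \<Rightarrow> ('n, 'k) mpoly set" where
  "chain_rule_set n F =
     {g. \<exists>w. \<forall>l. partial_deriv l g = (\<Sum>i<n. w i * partial_deriv l (F i))}"

lemma chain_rule_set_add:
  assumes "g \<in> chain_rule_set n F" "h \<in> chain_rule_set n F"
  shows "g + h \<in> chain_rule_set n F"
proof -
  obtain w w' where w: "\<And>l. partial_deriv l g = (\<Sum>i<n. w i * partial_deriv l (F i))"
    "\<And>l. partial_deriv l h = (\<Sum>i<n. w' i * partial_deriv l (F i))"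
    using assms unfolding chain_rule_set_def by auto
  then show ?thesis
    unfolding chain_rule_set_def
    by (intro CollectI exI[of _ "\<lambda>i. w i + w' i"]) (simp add: partial_deriv_add distrib_right sum.distrib)
qed

lemma chain_rule_set_mult:
  assumes "g \<in> chain_rule_set n F" "h \<in> chain_rule_set n F"
  shows "g * h \<in> chain_rule_set n F"
proof -
  obtain w w' where w: "\<And>l. partial_deriv l g = (\<Sum>i<n. w i * partial_deriv l (F i))"
    "\<And>l. partial_deriv l h = (\<Sum>i<n. w' i * partial_deriv l (F i))"
    using assms unfolding chain_rule_set_def by auto
  have "partial_deriv l (g * h) = (\<Sum>i<n. (w i * h + g * w' i) * partial_deriv l (F i))" for l
    unfolding partial_deriv_mult w sum_distrib_left sum_distrib_right sum.distrib[symmetric]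
    by (intro sum.cong) (simp_all add: algebra_simps)
  then show ?thesis
    unfolding chain_rule_set_def by (intro CollectI exI[of _ "\<lambda>i. w i * h + g * w' i"] allI)
qed

lemma chain_rule_set_const:
  "(\<And>l. partial_deriv l g = 0) \<Longrightarrow> g \<in> chain_rule_set n F"
  unfolding chain_rule_set_def by (intro CollectI exI[of _ "\<lambda>_. 0"]) simp

lemma chain_rule_set_gen:
  assumes "i < n" shows "F i \<in> chain_rule_set n F"
proof -
  have "(\<Sum>k<n. (if k = i then 1 else 0) * partial_deriv l (F k)) = partial_deriv l (F i)" for l
    using assms by (simp add: if_distrib[of "\<lambda>x. x * _"] cong: if_cong)
  then show ?thesis
    unfolding chain_rule_set_def by (intro CollectI exI[of _ "\<lambda>k. if k = i then 1 else 0"]) simp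
qed

lemma chain_rule_set_sum:
  "(\<And>a. a \<in> A \<Longrightarrow> G a \<in> chain_rule_set n F) \<Longrightarrow> sum G A \<in> chain_rule_set n F"
  by (induction A rule: infinite_finite_induct)
    (auto intro: chain_rule_set_add chain_rule_set_const simp: K_derivation_0[OF K_derivation_partial_deriv])

lemma chain_rule_set_prod:
  "(\<And>a. a \<in> A \<Longrightarrow> G a \<in> chain_rule_set n F) \<Longrightarrow> prod G A \<in> chain_rule_set n F"
  by (induction A rule: infinite_finite_induct)
    (auto intro: chain_rule_set_mult chain_rule_set_const simp: K_derivation_1[OF K_derivation_partial_deriv])

lemma chain_rule_set_power: "g \<in> chain_rule_set n F \<Longrightarrow> g ^ k \<in> chain_rule_set n F"
  using chain_rule_set_prod[of "{..<k}" "\<lambda>_. g" n F] by simp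

text \<open>The weights form a matrix whose product with the Jacobian matrix is \<open>v\<close>
  times the identity; take determinants.\<close>

lemma jac_dvd_of_chain_rule:
  fixes F :: "nat \<Rightarrow> ('n::{finite, linorder}, 'k::comm_ring_1) mpoly"
  assumes v: "\<And>l. partial_deriv l v = 0"
    and chain: "\<And>k. v * Var k \<in> chain_rule_set CARD('n) F"
  shows "jac CARD('n) F nth_var dvd v ^ CARD('n)"
proof -
  let ?n = "CARD('n)"
  have "\<forall>k. \<exists>w. \<forall>l. partial_deriv l (v * Var k) = (\<Sum>i<?n. w i * partial_deriv l (F i))"
    using chain by (simp add: chain_rule_set_def)
  from choice[OF this] obtain w where
    w: "\<And>k l. partial_deriv l (v * Var k) = (\<Sum>i<?n. w k i * partial_deriv l (F i))" by blast
  define W where "W = Matrix.mat ?n ?n (\<lambda>(k, i). w (nth_var k) i)"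
  have "W * jac_mat ?n F nth_var = v \<cdot>\<^sub>m 1\<^sub>m ?n"
  proof (rule eq_matI)
    fix k l assume "k < dim_row (v \<cdot>\<^sub>m 1\<^sub>m ?n :: ('n, 'k) mpoly mat)" "l < dim_col (v \<cdot>\<^sub>m 1\<^sub>m ?n :: ('n, 'k) mpoly mat)"
    then have kl: "k < ?n" "l < ?n" by simp_all
    have "(W * jac_mat ?n F nth_var) $$ (k, l) = (\<Sum>i<?n. w (nth_var k) i * partial_deriv (nth_var l) (F i))"
      using kl by (simp add: W_def scalar_prod_def lessThan_atLeast0)
    also have "\<dots> = v * partial_deriv (nth_var l) (Var (nth_var k))"
      unfolding w[symmetric] partial_deriv_mult v by simp
    also have "\<dots> = (v \<cdot>\<^sub>m 1\<^sub>m ?n) $$ (k, l)"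
      using kl by (auto simp: partial_deriv_Var nth_var_eq_iff)
    finally show "(W * jac_mat ?n F nth_var) $$ (k, l) = (v \<cdot>\<^sub>m 1\<^sub>m ?n) $$ (k, l)" .
  qed (simp_all add: W_def)
  then have "det (W * jac_mat ?n F nth_var) = v ^ ?n" by simp
  moreover have "det (W * jac_mat ?n F nth_var) = det W * jac ?n F nth_var"
    unfolding jac_def by (rule det_mult[of _ ?n]) (simp_all add: W_def)
  ultimately show ?thesis by (metis dvd_triv_right)
qed

section \<open>From a p-basis to coprime Jacobian coefficients\<close>

lemma p_basis_jacobian_dvd:
  fixes d :: "('n::{finite, linorder}, 'k::idom) mpoly \<Rightarrow> ('n, 'k) mpoly"
  assumes p: "CHAR('k) = p" "p > 0" and d: "K_derivation d"
    and basis: "p_basis p (constants d) (pow_subalg p) (CARD('n) - 1) z"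
  shows "\<exists>N. jacobian_derivation_of z (Var j) dvd d (Var j) ^ N \<or> d (Var j) = 0"
proof (cases "d (Var j) = 0")
  case False
  let ?m = "CARD('n) - 1" and ?y = "Var j :: ('n, 'k) mpoly"
  let ?I = "{..<?m} \<rightarrow>\<^sub>E {..<p}" and ?M = "\<lambda>e. \<Prod>i<?m. z i ^ e i"
  let ?F = "z(?m := ?y)"
  note basis' = basis[unfolded p_basis_def Let_def constants_def]
  note z0 = basis'[THEN conjunct1]
    and span = basis'[THEN conjunct2, THEN conjunct1]
    and indep = basis'[THEN conjunct2, THEN conjunct2]
  have z': "\<forall>i<?m. d (z i) = 0" using z0 by simp
  note z = z'[rule_format]
  \<comment> \<open>The denominator from the slice expansion of degree \<open>p - 1\<close>. Its
    exponent is a multiple of \<open>p\<close>, so all partial derivatives of \<open>v\<close>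
    vanish.\<close>
  define v where "v = d ?y ^ (p * (p - 1))"
  have v: "partial_deriv l v = 0" for l
    unfolding v_def power_mult
    by (rule K_derivation_power_0[OF K_derivation_partial_deriv
        K_derivation_power_CHAR[OF K_derivation_partial_deriv p(1)]])
  \<comment> \<open>A constant is a combination of monomials in \<open>z\<close> over the subring,
    to which the chain rule applies.\<close>
  have const: "r \<in> chain_rule_set CARD('n) ?F" if r: "d r = 0" for r
  proof -
    obtain b where b: "\<forall>e\<in>?I. b e \<in> pow_subalg p" "r = (\<Sum>e\<in>?I. b e * ?M e)"
      using bspec[OF span, of r] r by auto
    have "b e \<in> chain_rule_set CARD('n) ?F" if "e \<in> ?I" for e
      using b(1) that K_derivation_pow_subalg[OF K_derivation_partial_deriv p(1)]
      by (intro chain_rule_set_const) blast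
    moreover have "z i \<in> chain_rule_set CARD('n) ?F" if "i < ?m" for i
      using chain_rule_set_gen[of i "CARD('n)" ?F] that by simp
    ultimately show ?thesis
      unfolding b(2)
      by (intro chain_rule_set_sum chain_rule_set_mult chain_rule_set_prod chain_rule_set_power) auto
  qed
  have y: "?y \<in> chain_rule_set CARD('n) ?F"
    using chain_rule_set_gen[of ?m "CARD('n)" ?F] by simp
  have "v * Var k \<in> chain_rule_set CARD('n) ?F" for k
  proof -
    \<comment> \<open>The factor \<open>b\<close> is unrelated to \<open>d\<close>; the slice
      expansion below replaces it by the power \<open>v\<close> of \<open>d ?y\<close>.\<close>
    obtain b c where bc: "b \<in> pow_subalg p" "b \<noteq> 0" "\<forall>i<p. \<forall>e\<in>?I. c i e \<in> pow_subalg p"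
      "b * Var k = (\<Sum>i<p. (\<Sum>e\<in>?I. c i e * ?M e) * ?y ^ i)"
      using multiple_in_span[OF p d z' indep False, of "Var k"] by (elim exE conjE) (rule that)
    have "d (\<Sum>e\<in>?I. c i e * ?M e) = 0" if "i \<le> p - 1" for i
      by (rule K_derivation_span_0[OF d p(1) z]) (use bc(3) that p(2) in auto)
    moreover have "b * Var k = (\<Sum>i\<le>p - 1. (\<Sum>e\<in>?I. c i e * ?M e) * ?y ^ i)"
      using bc(4) p(2) by (cases p) (simp_all add: lessThan_Suc_atMost)
    ultimately obtain e where e: "\<forall>i\<le>p - 1. d (e i) = 0" "v * Var k = (\<Sum>i\<le>p - 1. e i * ?y ^ i)"
      using slice_expansion[OF p d K_derivation_pow_subalg[OF d p(1) bc(1)] bc(2),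
          of "p - 1" "\<lambda>i. \<Sum>e\<in>?I. c i e * ?M e" "Var k" ?y] p(2)
      unfolding v_def by auto
    show ?thesis
      unfolding e(2) using e(1) const y
      by (intro chain_rule_set_sum chain_rule_set_mult chain_rule_set_power) auto
  qed
  then have "jac CARD('n) ?F nth_var dvd v ^ CARD('n)" by (rule jac_dvd_of_chain_rule[OF v])
  then show ?thesis
    unfolding jacobian_derivation_of_eq v_def power_mult[symmetric] by blast
qed simp

text \<open>A prime dividing all values of the Jacobian derivation on variables divides a power of
  each \<open>d (Var j)\<close>, hence each \<open>d (Var j)\<close>, against their
  coprimality.\<close>

lemma p_basis_imp_coprime:
  fixes d :: "('n::{finite, linorder}, 'k::{idom, factorial_semiring}) mpoly \<Rightarrow> ('n, 'k) mpoly"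
  assumes p: "CHAR('k) = p" "p > 0" and d: "K_derivation d"
    and cop: "coprime_set (range (\<lambda>j. d (Var j)))"
    and basis: "p_basis p (constants d) (pow_subalg p) (CARD('n) - 1) z"
  shows "coprime_set (range (\<lambda>j. jacobian_derivation_of z (Var j)))"
  unfolding coprime_set_def
proof (intro allI impI)
  fix h assume h: "\<forall>s\<in>range (\<lambda>j. jacobian_derivation_of z (Var j)). h dvd s"
  \<comment> \<open>A positive exponent also covers \<open>d (Var j) = 0\<close>, since the zeroth
    power would be \<open>1\<close>.\<close>
  have pow: "\<exists>N. h dvd d (Var j) ^ Suc N" for j
  proof -
    obtain N where "jacobian_derivation_of z (Var j) dvd d (Var j) ^ N \<or> d (Var j) = 0"
      using p_basis_jacobian_dvd[OF p d basis] by blast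
    then have "h dvd d (Var j) ^ Suc N" using h by (auto intro: dvd_trans dvd_mult)
    then show ?thesis ..
  qed
  show "h dvd 1"
  proof (rule ccontr)
    assume nu: "\<not> h dvd 1"
    obtain q where q: "\<not> q dvd 1" "\<And>j. q dvd d (Var j)"
    proof (cases "h = 0")
      \<comment> \<open>If \<open>h\<close> is \<open>0\<close>, all \<open>d (Var j)\<close> vanish
        and \<open>0\<close> is a common non-unit divisor.\<close>
      case True
      then have "d (Var j) = 0" for j using pow[of j] by auto
      then show ?thesis using that[of 0] by simp
    next
      case False
      then obtain q where q: "prime_elem q" "q dvd h" using mpoly_prime_factor_exists nu by blast
      have "q dvd d (Var j)" for j
        using pow[of j] q by (meson dvd_trans prime_elem_dvd_power)
      moreover have "\<not> q dvd 1" using q(1) by (simp only: prime_elem_def) blast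
      ultimately show ?thesis using that by blast
    qed
    then show False using cop unfolding coprime_set_def by blast
  qed
qed

section \<open>From coprime Jacobian coefficients to a p-basis and a Jacobian derivation\<close>

lemma coprime_imp_p_basis:
  fixes d :: "('n::{finite, linorder}, 'k::{idom, factorial_semiring}) mpoly \<Rightarrow> ('n, 'k) mpoly"
  assumes p: "CHAR('k) = p" "p > 0" and d: "K_derivation d" and j0: "d (Var j0) \<noteq> 0"
    and f: "\<And>i. i < CARD('n) - 1 \<Longrightarrow> d (f i) = 0"
    and cop: "coprime_set (range (\<lambda>j. jacobian_derivation_of f (Var j)))"
  shows "p_basis p (constants d) (pow_subalg p) (CARD('n) - 1) f"
proof -
  let ?m = "CARD('n) - 1"
  let ?I = "{..<?m} \<rightarrow>\<^sub>E {..<p}" and ?M = "\<lambda>e. \<Prod>i<?m. f i ^ e i"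
  \<comment> \<open>Row \<open>k\<close> of the determinant of \<open>f\<close> and
    \<open>Var j\<close> is freed for the argument: \<open>E k j\<close> kills the other
    \<open>f i\<close> and sends \<open>f k\<close> to the value of the Jacobian derivation at
    \<open>Var j\<close>.\<close>
  define E where "E k j h = jac CARD('n) (f(?m := Var j, k := h)) nth_var" for k j and h :: "('n, 'k) mpoly"
  have key: "b dvd c e"
    if b: "b \<in> pow_subalg p" and c: "\<And>e. e \<in> ?I \<Longrightarrow> c e \<in> pow_subalg p"
      and dvd: "b dvd (\<Sum>e\<in>?I. c e * ?M e)" and e: "e \<in> ?I" for b c e
  proof (rule dvd_coeffs_of_dvd_monomial_sum[of ?m UNIV E p f b c e])
    show "K_derivation (E k j)" if "k < ?m" for k j
      unfolding E_def by (rule K_derivation_jac_update) (use that in simp)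
    show "E k j (f i) = 0" if "i < k" "k < ?m" for k j i
      using jac_update_other[of k "CARD('n)" i "f(?m := Var j)" nth_var] that by (simp add: E_def)
    show "b dvd h" if "k < ?m" "\<And>j. j \<in> UNIV \<Longrightarrow> b dvd E k j (f k) * h" for k h
    proof (rule dvd_of_coprime_set[OF cop])
      fix s assume "s \<in> range (\<lambda>j. jacobian_derivation_of f (Var j))"
      then obtain j where s: "s = jacobian_derivation_of f (Var j)" by blast
      have "f(?m := Var j, k := f k) = f(?m := Var j)" using that(1) by (auto simp: fun_eq_iff)
      then have "E k j (f k) = s" by (simp add: E_def s jacobian_derivation_of_eq)
      then show "b dvd s * h" using that(2)[of j] by simp
    qed
  qed (use p b c dvd e in simp_all)
  have indep: "\<forall>c. (\<forall>e\<in>?I. c e \<in> pow_subalg p) \<and> (\<Sum>e\<in>?I. c e * ?M e) = 0 \<longrightarrow> (\<forall>e\<in>?I. c e = 0)"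
  proof (intro allI impI ballI, elim conjE)
    fix c e assume c: "\<forall>e\<in>?I. c e \<in> pow_subalg p" "(\<Sum>e\<in>?I. c e * ?M e) = 0" and e: "e \<in> ?I"
    \<comment> \<open>Independence is the case \<open>b = 0\<close> of \<open>key\<close>.\<close>
    have "0 dvd c e"
    proof (rule key[OF is_subring_0[OF is_subring_generated_subalgebra] _ _ e])
      show "c e \<in> pow_subalg p" if "e \<in> ?I" for e using c(1) that by (rule bspec)
      show "0 dvd (\<Sum>e\<in>?I. c e * ?M e)" unfolding c(2) by (rule dvd_refl)
    qed
    then show "c e = 0" by simp
  qed
  have f': "\<forall>i<?m. d (f i) = 0" using f by blast
  have span: "\<exists>b. (\<forall>e\<in>?I. b e \<in> pow_subalg p) \<and> r = (\<Sum>e\<in>?I. b e * ?M e)" if r: "d r = 0" for r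
  proof -
    obtain b c where bc: "b \<in> pow_subalg p" "b \<noteq> 0" "\<forall>i<p. \<forall>e\<in>?I. c i e \<in> pow_subalg p"
      "b * r = (\<Sum>i<p. (\<Sum>e\<in>?I. c i e * ?M e) * Var j0 ^ i)"
      using multiple_in_span[OF p d f' indep j0, of r] by (elim exE conjE) (rule that)
    define C where "C i = (\<Sum>e\<in>?I. c i e * ?M e)" for i
    have db: "d b = 0" by (rule K_derivation_pow_subalg[OF d p(1) bc(1)])
    \<comment> \<open>As \<open>b * r\<close> is itself a constant, comparing coefficients of
      \<open>Var j0 ^ 0\<close> removes the other powers of \<open>Var j0\<close>.\<close>
    have "0 dvd C 0 - (if 0 = (0::nat) then b * r else 0)"
    proof (rule dvd_coeffs_of_dvd_power_sum[of "{()}" "\<lambda>_. d" p 0 "Var j0" p "\<lambda>i. C i - (if i = 0 then b * r else 0)"])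
      show "d (C i - (if i = 0 then b * r else 0)) = 0" if "i < p" for i
      proof -
        have "d (C i) = 0"
          unfolding C_def by (rule K_derivation_span_0[OF d p(1) f]) (use bc(3) that in auto)
        then show ?thesis
          by (simp add: K_derivation_diff[OF d] K_derivation_mult[OF d] K_derivation_0[OF d] db r)
      qed
      have "(\<Sum>i<p. (if i = 0 then b * r else 0) * Var j0 ^ i) = b * r"
        using p(2) by (simp add: if_distrib[of "\<lambda>x. x * _"] cong: if_cong)
      then show "0 dvd (\<Sum>i<p. (C i - (if i = 0 then b * r else 0)) * Var j0 ^ i)"
        using bc(4) by (simp add: left_diff_distrib sum_subtractf C_def)
    qed (use d p j0 in \<open>simp_all add: K_derivation_0\<close>)
    then have br: "b * r = (\<Sum>e\<in>?I. c 0 e * ?M e)" by (simp add: C_def)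
    have c0: "c 0 e \<in> pow_subalg p" if "e \<in> ?I" for e using bc(3) p(2) that by blast
    have dvd: "b dvd c 0 e" if e: "e \<in> ?I" for e
    proof (rule key[OF bc(1) _ _ e])
      show "b dvd (\<Sum>e\<in>?I. c 0 e * ?M e)" unfolding br[symmetric] by (rule dvd_triv_left)
    qed (rule c0)
    \<comment> \<open>The quotients of the coefficients by \<open>b\<close> lie in the subring by
      saturation, and cancelling \<open>b\<close> expresses \<open>r\<close> itself.\<close>
    define g where "g e = (SOME x. c 0 e = b * x)" for e
    have g: "c 0 e = b * g e" if "e \<in> ?I" for e
      unfolding g_def by (rule someI_ex[OF dvd[OF that, unfolded dvd_def]])
    have "g e \<in> pow_subalg p" if "e \<in> ?I" for e
      using c0[OF that] unfolding g[OF that] by (rule pow_subalg_saturated[OF bc(1,2)])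
    moreover have "b * r = b * (\<Sum>e\<in>?I. g e * ?M e)"
      unfolding br sum_distrib_left by (intro sum.cong) (simp_all add: g mult.assoc)
    then have "r = (\<Sum>e\<in>?I. g e * ?M e)" using bc(2) by simp
    ultimately show ?thesis by blast
  qed
  show ?thesis
    unfolding p_basis_def Let_def constants_def
  proof (intro conjI)
    show "\<forall>i<?m. f i \<in> {a. d a = 0}" using f by simp
    show "\<forall>r\<in>{a. d a = 0}. \<exists>b. (\<forall>e\<in>?I. b e \<in> pow_subalg p) \<and> r = (\<Sum>e\<in>?I. b e * ?M e)"
      using span by blast
  qed (rule indep)
qed

text \<open>The two derivations are proportional. Coprimality on either side makes their values at
  \<open>Var j0\<close> divide each other, so the factor between them is a unit and hence a constant
  of K.\<close>

lemma coprime_imp_jacobian: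
  fixes d :: "('n::{finite, linorder}, 'k::{idom, factorial_semiring}) mpoly \<Rightarrow> ('n, 'k) mpoly"
  assumes n: "CARD('n) \<ge> 2" and d: "K_derivation d" and j0: "d (Var j0) \<noteq> 0"
    and copd: "coprime_set (range (\<lambda>j. d (Var j)))"
    and f: "\<And>i. i < CARD('n) - 1 \<Longrightarrow> d (f i) = 0"
    and cop: "coprime_set (range (\<lambda>j. jacobian_derivation_of f (Var j)))"
  shows "is_jacobian_derivation d"
proof -
  let ?D = "jacobian_derivation_of f"
  note D = K_derivation_jacobian_derivation_of[of f]
  have ratio: "?D (Var j0) * d (Var j) = d (Var j0) * ?D (Var j)" for j
    by (rule derivation_proportional[OF d f])
  have "?D (Var j0) dvd d (Var j0)"
    by (rule dvd_of_coprime_set[OF cop]) (auto simp: ratio[symmetric] mult.commute[of "?D _" "d (Var j0)"])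
  then obtain u where u: "d (Var j0) = ?D (Var j0) * u" ..
  have "d (Var j0) dvd ?D (Var j0)"
    by (rule dvd_of_coprime_set[OF copd]) (auto simp: ratio mult.commute[of "d _" "?D (Var j0)"])
  then obtain v where v: "?D (Var j0) = d (Var j0) * v" ..
  have "d (Var j0) = d (Var j0) * (u * v)" using u v by (metis mult.assoc mult.commute)
  then have "u * v = 1" using j0 by simp
  then have "u dvd 1" by (metis dvd_triv_left)
  then obtain a where a: "u = Const a" by (rule mpoly_unit_const)
  have D0: "?D (Var j0) \<noteq> 0" using u j0 by auto
  have "d (Var j) = Const a * ?D (Var j)" for j
  proof -
    have "?D (Var j0) * d (Var j) = ?D (Var j0) * (Const a * ?D (Var j))"
      unfolding ratio using u a by (simp add: mult.assoc)
    then show ?thesis using D0 by simp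
  qed
  moreover have "K_derivation (\<lambda>g. Const a * ?D g)"
    using K_derivation_comb[of "{()}" "\<lambda>_. ?D" "\<lambda>_. Const a"] D by (simp add: mult.commute)
  ultimately have da: "d g = Const a * ?D g" for g
    using K_derivation_eqI[OF d] by blast
  \<comment> \<open>The factor \<open>a\<close> goes into row \<open>0\<close>, which differs from
    the last row because there are at least two variables.\<close>
  define F where "F = f(0 := Const a * f 0)"
  have "jacobian_derivation_of F g = d g" for g
  proof -
    let ?f = "f(CARD('n) - 1 := g)"
    have "F(CARD('n) - 1 := g) = ?f(0 := Const a * ?f 0)"
      using n by (auto simp: F_def fun_eq_iff)
    then have "jacobian_derivation_of F g = jac CARD('n) (?f(0 := Const a * ?f 0)) nth_var"
      by (simp add: jacobian_derivation_of_eq)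
    also have "\<dots> = Const a * jac CARD('n) (?f(0 := ?f 0)) nth_var"
      by (rule K_derivation_scale[OF K_derivation_jac_update]) simp
    also have "\<dots> = d g" unfolding fun_upd_triv da jacobian_derivation_of_eq ..
    finally show ?thesis .
  qed
  then show ?thesis unfolding is_jacobian_derivation_def by (intro exI[of _ F]) (simp add: fun_eq_iff)
qed

section \<open>Coprimality in terms of gcds and minors, and the equivalence of the three
  conditions\<close>

lemma ex_gcd_sim_1_iff:
  "(\<exists>g. is_gcd_of g S \<and> g \<sim> (1 :: ('n, 'k::comm_ring_1) mpoly)) \<longleftrightarrow> coprime_set S"
proof
  assume "\<exists>g. is_gcd_of g S \<and> g \<sim> 1"
  then obtain g a where g: "is_gcd_of g S" "a dvd 1" "g = Const a" by (auto simp: sim_def)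
  obtain b where "1 = a * b" using g(2) ..
  then have "g * Const b = 1" unfolding g(3) by (metis Const_simps(2,5))
  then have "g dvd 1" by (metis dvd_triv_left)
  then show "coprime_set S" using g(1) unfolding coprime_set_def is_gcd_of_def by (meson dvd_trans)
next
  assume "coprime_set S"
  moreover have "(1 :: ('n, 'k) mpoly) \<sim> 1" unfolding sim_def by (intro exI[of _ 1]) simp
  ultimately show "\<exists>g. is_gcd_of g S \<and> g \<sim> 1"
    unfolding coprime_set_def is_gcd_of_def by (intro exI[of _ 1]) simp
qed

text \<open>Both families have the same common divisors: the values at variables are minors up to
  sign, and a minor with arbitrary columns is a multiple of such a value.\<close>

lemma coprime_minors_iff:
  fixes f :: "nat \<Rightarrow> ('n::{finite, linorder}, 'k::comm_ring_1) mpoly"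
  shows "coprime_set (range (\<lambda>js. jac (CARD('n) - 1) f js)) \<longleftrightarrow>
    coprime_set (range (\<lambda>j. jacobian_derivation_of f (Var j)))"
  unfolding coprime_set_def
  using jacobian_derivation_of_Var_dvd[of _ f] dvd_jac_minor[of _ f] by auto

theorem theorem3p4:
  fixes d :: "('n::{finite, linorder}, 'k::{idom, factorial_semiring}) mpoly \<Rightarrow> ('n, 'k) mpoly"
    and p :: nat
  assumes "CARD('n) \<ge> 2"
    and "CHAR('k) = p" and "p > 0"
    and "K_derivation d"
    and "d \<noteq> (\<lambda>_. 0)"
    and "\<exists>g. is_gcd_of g (range (\<lambda>j. d (Var j))) \<and> g \<sim> 1"
  shows
    "((\<exists>z. p_basis p (constants d) (generated_subalgebra (range (\<lambda>j. Var j ^ p))) (CARD('n) - 1) z)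
        \<longleftrightarrow> is_jacobian_derivation d) \<and>
     (is_jacobian_derivation d \<longleftrightarrow>
       (\<exists>f. (\<forall>i < CARD('n) - 1. f i \<in> constants d) \<and>
            (\<exists>g. is_dgcd g (CARD('n) - 1) f \<and> g \<sim> 1)))"
proof -
  note p = assms(2,3) and d = assms(4)
  have cop: "coprime_set (range (\<lambda>j. d (Var j)))" using assms(6) by (simp add: ex_gcd_sim_1_iff)
  have "\<exists>j. d (Var j) \<noteq> 0"
  proof (rule ccontr)
    assume "\<not> ?thesis"
    then have "d g = 0" for g using K_derivation_eq_sum[OF d, of g] by simp
    then show False using assms(5) by (simp add: fun_eq_iff)
  qed
  then obtain j0 where j0: "d (Var j0) \<noteq> 0" ..
  \<comment> \<open>The third condition with minors replaced by values of the Jacobian derivation;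
    the other two conditions are compared with it.\<close>
  define Q where "Q f \<longleftrightarrow> (\<forall>i<CARD('n) - 1. d (f i) = 0) \<and>
    coprime_set (range (\<lambda>j. jacobian_derivation_of f (Var j)))" for f
  have 3: "(\<exists>f. (\<forall>i < CARD('n) - 1. f i \<in> constants d) \<and>
      (\<exists>g. is_dgcd g (CARD('n) - 1) f \<and> g \<sim> 1)) \<longleftrightarrow> (\<exists>f. Q f)"
    unfolding Q_def is_dgcd_def ex_gcd_sim_1_iff coprime_minors_iff constants_def by simp
  have 13: "Q z" if "p_basis p (constants d) (pow_subalg p) (CARD('n) - 1) z" for z
    unfolding Q_def
  proof
    show "\<forall>i<CARD('n) - 1. d (z i) = 0"
      using that[unfolded p_basis_def Let_def constants_def, THEN conjunct1] by simp
  qed (rule p_basis_imp_coprime[OF p d cop that])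
  have 31: "p_basis p (constants d) (pow_subalg p) (CARD('n) - 1) f" if "Q f" for f
    by (rule coprime_imp_p_basis[OF p d j0]) (use that in \<open>simp_all add: Q_def\<close>)
  have 32: "is_jacobian_derivation d" if "Q f" for f
    by (rule coprime_imp_jacobian[OF assms(1) d j0 cop, of f]) (use that in \<open>simp_all add: Q_def\<close>)
  have 23: "\<exists>f. Q f" if jd: "is_jacobian_derivation d"
  proof -
    obtain F where F: "d = jacobian_derivation_of F" using jd unfolding is_jacobian_derivation_def by blast
    \<comment> \<open>The family defining \<open>d\<close> itself works: its Jacobian derivation is
      \<open>d\<close>, whose values on variables are coprime by assumption.\<close>
    have "Q F"
      unfolding Q_def
    proof (intro conjI allI impI)
      show "d (F i) = 0" if "i < CARD('n) - 1" for i
        unfolding F by (rule jacobian_derivation_of_const[OF that])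
      show "coprime_set (range (\<lambda>j. jacobian_derivation_of F (Var j)))"
        using cop unfolding F .
    qed
    then show ?thesis by (rule exI[of Q])
  qed
  have "\<exists>z. p_basis p (constants d) (pow_subalg p) (CARD('n) - 1) z" if "is_jacobian_derivation d"
    using 23[OF that] 31 by (elim exE) (rule exI)
  moreover have "is_jacobian_derivation d"
    if "\<exists>z. p_basis p (constants d) (pow_subalg p) (CARD('n) - 1) z"
    using that by (elim exE) (rule 32[OF 13])
  moreover have "is_jacobian_derivation d" if "\<exists>f. Q f" using that 32 by (elim exE)
  ultimately show ?thesis unfolding 3 using 23 by (intro conjI iffI)
qed

end
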